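(* Let $G$ be a finitely generated virtually abelian group, let $n$ be a positive integer, and let $V\subseteq G^n$ be an algebraic set of $G$. Then for every finite generating set $S$ of $G$ with weight function $\|\cdot\|\colon S\to\mathbb{Z}_{>0}$, the weighted multivariate growth series $\mathbb{M}_{V\subseteq G^n,S}(z_1,\ldots,z_n)$ is holonomic.
   Context: Algebraic set: a finite system of equations in $G$ with $n$ variables is a finite subset $\{w_1,\ldots,w_m\}$ of $G*F_n$, with $F_n$ free on $X_1,\ldots,X_n$; its solution set is the set of $(x_1,\ldots,x_n)\in G^n$ such that the homomorphism $G*F_n\to G$ that is the identity on $G$ and sends $X_i\mapsto x_i$ maps every $w_j$ to $1_G$. An algebraic set of $G$ is the solution set in $G^n$ of a finite system of equations in $n$ variables. Growth: $S$ generates $G$ in the sense that every element is represented by a word in $S^*$. Extend the weight to words by $\|s_1\cdots s_l\|=\sum_i\|s_i\|$ and put $\|g\|=\min\{\|w\|\mid w\in S^*,\ w=_Gg\}$ for $g\in G$. For $V\subseteq G^n$ the weighted multivariate growth series is $\mathbb{M}_{V\subseteq G^n,S}(z_1,\ldots,z_n)=\sum_{(x_1,\ldots,x_n)\in V}z_1^{\|x_1\|}\cdots z_n^{\|x_n\|}\in\mathbb{Q}[[z_1,\ldots,z_n]]$. Holonomic: $f(z_1,\ldots,z_n)$ is holonomic if the span over the field of rational functions $\mathbb{C}(z_1,\ldots,z_n)$ of the set of partial derivatives $\{\partial_{z_1}^{j_1}\cdots\partial_{z_n}^{j_n}f\mid j_1,\ldots,j_n\in\mathbb{Z}_{\ge0}\}$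 is finite-dimensional (for formal power series, this span is taken inside the field of fractions of $\mathbb{C}[[z_1,\ldots,z_n]]$). *)

theory Defs
  imports
    Complex_Main
    "HOL-Library.Poly_Mapping"
    "HOL-Analysis.Finite_Cartesian_Product"
    "HOL-Computational_Algebra.Fraction_Field"
    "HOL-Algebra.Generated_Groups"
begin

section \<open>Formal power series in finitely many variables\<close>

text \<open>
  The variables are indexed by a type \<^typ>\<open>'n\<close> of class \<^class>\<open>finite\<close>, so there are
  \<open>n = CARD('n)\<close> of them, and \<open>n \<ge> 1\<close> because types are nonempty. An element \<open>m\<close> of
  \<^typ>\<open>nat^'n\<close> stands for the monomial that is the product of the \<open>z\<^sub>i ^ (m $ i)\<close>.
\<close>

typedef ('a, 'n) mfps = "UNIV :: (nat^'n::finite \<Rightarrow> 'a) set"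
  morphisms mfps_nth Mfps ..

declare Mfps_inverse [OF UNIV_I, simp]

lemma mfps_eqI: "(\<And>m. mfps_nth f m = mfps_nth g m) \<Longrightarrow> f = g"
  by (metis ext mfps_nth_inject)

definition splits :: "nat^'n::finite \<Rightarrow> ((nat^'n) \<times> (nat^'n)) set" where
  "splits m = {(p, q). p + q = m}"

lemma finite_vec_le: "finite {p :: nat^'n::finite. \<forall>i. p $ i \<le> k}"
proof -
  have "{p :: nat^'n. \<forall>i. p $ i \<le> k} \<subseteq> vec_lambda ` (UNIV \<rightarrow>\<^sub>E {..k})"
  proof
    fix p :: "nat^'n" assume "p \<in> {p. \<forall>i. p $ i \<le> k}"
    then have "vec_nth p \<in> UNIV \<rightarrow>\<^sub>E {..k}" by auto
    then show "p \<in> vec_lambda ` (UNIV \<rightarrow>\<^sub>E {..k})"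
      by (metis image_eqI vec_lambda_eta)
  qed
  moreover have "finite (vec_lambda ` ((UNIV :: 'n set) \<rightarrow>\<^sub>E {..k}))"
    by (intro finite_imageI finite_PiE) auto
  ultimately show ?thesis by (rule finite_subset)
qed

lemma finite_splits [simp]: "finite (splits (m :: nat^'n::finite))"
proof -
  let ?B = "{p :: nat^'n. \<forall>i. p $ i \<le> (\<Sum>i\<in>UNIV. m $ i)}"
  have *: "m $ i \<le> (\<Sum>i\<in>UNIV. m $ i)" for i
    by (rule member_le_sum) auto
  have "splits m \<subseteq> ?B \<times> ?B"
  proof
    fix x assume "x \<in> splits m"
    then have "fst x + snd x = m" by (auto simp: splits_def)
    then have "fst x $ i + snd x $ i = m $ i" for i by auto
    then have "fst x $ i \<le> (\<Sum>i\<in>UNIV. m $ i)" "snd x $ i \<le> (\<Sum>i\<in>UNIV. m $ i)" for i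
      using *[of i] by (metis add_leD1 add_leD2)+
    then show "x \<in> ?B \<times> ?B" by (simp add: mem_Times_iff)
  qed
  then show ?thesis
    by (rule finite_subset) (intro finite_cartesian_product finite_vec_le)
qed

instantiation mfps :: (comm_ring_1, finite) comm_ring_1
begin

definition "0 = Mfps (\<lambda>_. 0)"
definition "1 = Mfps (\<lambda>m. if m = 0 then 1 else 0)"
definition "f + g = Mfps (\<lambda>m. mfps_nth f m + mfps_nth g m)"
definition "f - g = Mfps (\<lambda>m. mfps_nth f m - mfps_nth g m)"
definition "- f = Mfps (\<lambda>m. - mfps_nth f m)"
definition "f * g = Mfps (\<lambda>m. \<Sum>(p, q)\<in>splits m. mfps_nth f p * mfps_nth g q)"

instance
proof
  fix f g h :: "('a, 'b) mfps"
  show "f * g * h = f * (g * h)"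
  proof (rule mfps_eqI)
    fix m :: "nat^'b"
    have "mfps_nth (f * g * h) m =
        (\<Sum>((p, q), (r, s))\<in>(SIGMA x:splits m. splits (fst x)).
          mfps_nth f r * mfps_nth g s * mfps_nth h q)"
      by (simp add: times_mfps_def sum_distrib_right sum.Sigma split_def)
    also have "\<dots> = (\<Sum>((p, q), (r, s))\<in>(SIGMA x:splits m. splits (snd x)).
          mfps_nth f p * (mfps_nth g r * mfps_nth h s))"
      by (rule sum.reindex_bij_witness
          [where i = "\<lambda>((p, q), (r, s)). ((p + r, s), (p, r))"
             and j = "\<lambda>((p, q), (r, s)). ((r, s + q), (s, q))"])
         (auto simp: splits_def algebra_simps)
    also have "\<dots> = mfps_nth (f * (g * h)) m"
      by (simp add: times_mfps_def sum_distrib_left sum.Sigma split_def)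
    finally show "mfps_nth (f * g * h) m = mfps_nth (f * (g * h)) m" .
  qed
  show "f * g = g * f"
  proof (rule mfps_eqI)
    fix m :: "nat^'b"
    show "mfps_nth (f * g) m = mfps_nth (g * f) m"
      unfolding times_mfps_def Mfps_inverse[OF UNIV_I]
      by (rule sum.reindex_bij_witness[where i = prod.swap and j = prod.swap])
         (auto simp: splits_def algebra_simps)
  qed
  show "1 * f = f"
  proof (rule mfps_eqI)
    fix m :: "nat^'b"
    have "mfps_nth (1 * f) m = (\<Sum>x\<in>splits m. if x = (0, m) then mfps_nth f m else 0)"
      unfolding times_mfps_def one_mfps_def Mfps_inverse[OF UNIV_I]
      by (rule sum.cong) (auto simp: splits_def split: if_splits)
    also have "\<dots> = mfps_nth f m"
      by (subst sum.delta) (simp_all, simp add: splits_def)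
    finally show "mfps_nth (1 * f) m = mfps_nth f m" .
  qed
  show "(0 :: ('a, 'b) mfps) \<noteq> 1"
    by (metis (mono_tags) Mfps_inverse UNIV_I one_mfps_def zero_mfps_def zero_neq_one)
qed (auto intro!: mfps_eqI simp: plus_mfps_def minus_mfps_def uminus_mfps_def zero_mfps_def
      times_mfps_def algebra_simps sum.distrib split_def)

end

lemma mfps_nth_zero [simp]: "mfps_nth 0 m = 0"
  by (simp add: zero_mfps_def)

lemma mfps_nth_mult: "mfps_nth (f * g) m = (\<Sum>(p, q)\<in>splits m. mfps_nth f p * mfps_nth g q)"
  by (simp add: times_mfps_def)

text \<open>
  To see that there are no zero divisors, compare the coefficients at the least elements of the
  supports for the degree-lexicographic order, which is obtained from the library's
  lexicographic order on \<^typ>\<open>nat \<Rightarrow>\<^sub>0 nat\<close>.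
\<close>

definition vec_pm :: "nat^'n::finite \<Rightarrow> nat \<Rightarrow>\<^sub>0 nat" where
  "vec_pm m = (\<Sum>i\<in>UNIV. Poly_Mapping.single
     ((SOME e :: 'n \<Rightarrow> nat. inj e) i) (m $ i))"

lemma vec_pm_add: "vec_pm (p + q) = vec_pm p + vec_pm q"
  by (simp add: vec_pm_def single_add sum.distrib)

lemma inj_vec_pm: "inj (vec_pm :: nat^'n::finite \<Rightarrow> _)"
proof (rule injI)
  fix p q :: "nat^'n" assume eq: "vec_pm p = vec_pm q"
  define e :: "'n \<Rightarrow> nat" where "e = (SOME e. inj e)"
  have "\<exists>e :: 'n \<Rightarrow> nat. inj e"
    using finite_imp_inj_to_nat_seg[of "UNIV :: 'n set"] by auto
  then have e: "inj e" unfolding e_def by (rule someI_ex)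
  have *: "Poly_Mapping.lookup (vec_pm r) (e i) = r $ i" for r :: "nat^'n" and i
  proof -
    have "Poly_Mapping.lookup (vec_pm r) (e i) =
        (\<Sum>j\<in>UNIV. if j = i then r $ i else 0)"
      unfolding vec_pm_def e_def[symmetric] lookup_sum
      by (rule sum.cong) (auto simp: lookup_single when_def inj_eq[OF e])
    then show ?thesis by simp
  qed
  show "p = q" using *[of p] *[of q] eq by (simp add: vec_eq_iff)
qed

lemma mfps_lowest:
  fixes f :: "('a::zero, 'n::finite) mfps"
  assumes "\<exists>m. mfps_nth f m \<noteq> 0"
  obtains a where "mfps_nth f a \<noteq> 0"
    "\<And>p. mfps_nth f p \<noteq> 0 \<Longrightarrow> (\<Sum>i\<in>UNIV. a $ i) \<le> (\<Sum>i\<in>UNIV. p $ i)"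
    "\<And>p. mfps_nth f p \<noteq> 0 \<Longrightarrow> (\<Sum>i\<in>UNIV. p $ i) = (\<Sum>i\<in>UNIV. a $ i) \<Longrightarrow> vec_pm a \<le> vec_pm p"
proof -
  let ?deg = "\<lambda>p :: nat^'n. \<Sum>i\<in>UNIV. p $ i"
  obtain c where c: "mfps_nth f c \<noteq> 0" "\<And>p. mfps_nth f p \<noteq> 0 \<Longrightarrow> ?deg c \<le> ?deg p"
    using assms ex_has_least_nat[of "\<lambda>m. mfps_nth f m \<noteq> 0" _ ?deg] by blast
  let ?L = "{p. mfps_nth f p \<noteq> 0 \<and> ?deg p = ?deg c}"
  have "?L \<subseteq> {p. \<forall>i. p $ i \<le> ?deg c}"
  proof clarify
    fix p :: "nat^'n" and i assume "?deg p = ?deg c"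
    then show "p $ i \<le> ?deg c" by (metis UNIV_I finite member_le_sum zero_le)
  qed
  then have fin: "finite ?L" using finite_subset finite_vec_le by blast
  moreover have "c \<in> ?L" using c by simp
  ultimately have "Min (vec_pm ` ?L) \<in> vec_pm ` ?L"
    by (intro Min_in) auto
  then obtain a where a: "a \<in> ?L" "vec_pm a = Min (vec_pm ` ?L)" by force
  show thesis
  proof (rule that)
    show "mfps_nth f a \<noteq> 0" using a by simp
    show "?deg a \<le> ?deg p" if "mfps_nth f p \<noteq> 0" for p using a c that by simp
    show "vec_pm a \<le> vec_pm p" if "mfps_nth f p \<noteq> 0" "?deg p = ?deg a" for p
    proof -
      have "p \<in> ?L" using that a by simp
      then show ?thesis unfolding a(2) using fin by (intro Min_le) auto
    qed
  qed
qed

instance mfps :: (idom, finite) idom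
proof
  fix f g :: "('a, 'b) mfps"
  assume "f \<noteq> 0" "g \<noteq> 0"
  then have "\<exists>m. mfps_nth f m \<noteq> 0" "\<exists>m. mfps_nth g m \<noteq> 0"
    by (metis mfps_eqI mfps_nth_zero)+
  let ?deg = "\<lambda>p :: nat^'b. \<Sum>i\<in>UNIV. p $ i"
  obtain a where a: "mfps_nth f a \<noteq> 0"
    "\<And>p. mfps_nth f p \<noteq> 0 \<Longrightarrow> ?deg a \<le> ?deg p"
    "\<And>p. mfps_nth f p \<noteq> 0 \<Longrightarrow> ?deg p = ?deg a \<Longrightarrow> vec_pm a \<le> vec_pm p"
    using mfps_lowest[OF \<open>\<exists>m. mfps_nth f m \<noteq> 0\<close>] by blast
  obtain b where b: "mfps_nth g b \<noteq> 0"
    "\<And>p. mfps_nth g p \<noteq> 0 \<Longrightarrow> ?deg b \<le> ?deg p"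
    "\<And>p. mfps_nth g p \<noteq> 0 \<Longrightarrow> ?deg p = ?deg b \<Longrightarrow> vec_pm b \<le> vec_pm p"
    using mfps_lowest[OF \<open>\<exists>m. mfps_nth g m \<noteq> 0\<close>] by blast
  have "mfps_nth f p * mfps_nth g q = (if (p, q) = (a, b) then mfps_nth f a * mfps_nth g b else 0)"
    if pq: "p + q = a + b" for p q
  proof (cases "mfps_nth f p = 0 \<or> mfps_nth g q = 0")
    case True
    with a(1) b(1) show ?thesis by auto
  next
    case False
    have "?deg p + ?deg q = ?deg (p + q)" by (simp add: sum.distrib)
    also have "\<dots> = ?deg a + ?deg b" by (simp add: pq sum.distrib)
    finally have deg: "?deg p = ?deg a" "?deg q = ?deg b"
      using a(2)[of p] b(2)[of q] False by auto
    have le: "vec_pm a \<le> vec_pm p" "vec_pm b \<le> vec_pm q"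
      using a(3) b(3) deg False by auto
    have "vec_pm p + vec_pm q = vec_pm a + vec_pm b"
      using pq vec_pm_add by metis
    then have "vec_pm p = vec_pm a"
      using le by (metis add_le_cancel_right add_left_mono antisym)
    then have "p = a" using inj_vec_pm by (metis injD)
    then show ?thesis using pq by simp
  qed
  note coeff = this
  have "mfps_nth (f * g) (a + b) =
      (\<Sum>x\<in>splits (a + b). if x = (a, b) then mfps_nth f a * mfps_nth g b else 0)"
    unfolding mfps_nth_mult
  proof (rule sum.cong)
    fix x assume "x \<in> splits (a + b)"
    then show "(case x of (p, q) \<Rightarrow> mfps_nth f p * mfps_nth g q) =
        (if x = (a, b) then mfps_nth f a * mfps_nth g b else 0)"
      using coeff[of "fst x" "snd x"] by (simp add: splits_def split_beta)
  qed simp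
  also have "\<dots> = mfps_nth f a * mfps_nth g b"
    by (subst sum.delta) (simp_all, simp add: splits_def)
  finally show "f * g \<noteq> 0" using a(1) b(1) by auto
qed


section \<open>Holonomic power series\<close>

definition mfps_pderiv :: "'n \<Rightarrow> ('a::comm_ring_1, 'n::finite) mfps \<Rightarrow> ('a, 'n) mfps" where
  "mfps_pderiv i f = Mfps (\<lambda>m. of_nat (m $ i + 1) * mfps_nth f (m + axis i 1))"

text \<open>
  The partial derivatives commute (see below), so closing \<open>f\<close> under all of them gives exactly the
  mixed derivatives in which the variables occur in a fixed order.
\<close>

inductive_set mfps_derivs :: "('a::comm_ring_1, 'n::finite) mfps \<Rightarrow> ('a, 'n) mfps set"
  for f where
  base: "f \<in> mfps_derivs f"
| step: "g \<in> mfps_derivs f \<Longrightarrow> mfps_pderiv i g \<in> mfps_derivs f"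

lemma mfps_pderiv_commute: "mfps_pderiv i (mfps_pderiv j f) = mfps_pderiv j (mfps_pderiv i f)"
  by (rule mfps_eqI) (simp add: mfps_pderiv_def axis_def algebra_simps)

definition mfps_polynomial :: "('a::comm_ring_1, 'n::finite) mfps \<Rightarrow> bool" where
  "mfps_polynomial f \<longleftrightarrow> finite {m. mfps_nth f m \<noteq> 0}"

text \<open>The field of rational functions is taken as a subfield of the fraction field of power series.\<close>

definition rational_functions :: "('a::idom, 'n::finite) mfps fract set" where
  "rational_functions =
     {Fract p q | p q. mfps_polynomial p \<and> mfps_polynomial q \<and> q \<noteq> 0}"

definition rational_span ::
    "('a::idom, 'n::finite) mfps fract set \<Rightarrow> ('a, 'n) mfps fract set" where
  "rational_span D =
     {\<Sum>d\<in>A. c d * d | A c. finite A \<and> A \<subseteq> D \<and> (\<forall>d\<in>A. c d \<in> rational_functions)}"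

definition holonomic :: "(complex, 'n::finite) mfps \<Rightarrow> bool" where
  "holonomic f \<longleftrightarrow>
     (\<exists>B. finite B \<and> rational_span ((\<lambda>g. Fract g 1) ` mfps_derivs f) = rational_span B)"


section \<open>Presentations, free groups and free products\<close>

text \<open>
  \<open>word_cong A R\<close> is the congruence on the free monoid of words over \<open>A\<close> generated by the
  relations \<open>u = v\<close> for \<open>(u, v) \<in> R\<close>.
\<close>

inductive word_cong :: "'l set \<Rightarrow> ('l list \<times> 'l list) set \<Rightarrow> 'l list \<Rightarrow> 'l list \<Rightarrow> bool"
  for A R where
  refl: "w \<in> lists A \<Longrightarrow> word_cong A R w w"
| sym: "word_cong A R u v \<Longrightarrow> word_cong A R v u"
| trans: "word_cong A R u v \<Longrightarrow> word_cong A R v w \<Longrightarrow> word_cong A R u w"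
| rel: "(u, v) \<in> R \<Longrightarrow> u \<in> lists A \<Longrightarrow> v \<in> lists A \<Longrightarrow> p \<in> lists A \<Longrightarrow> q \<in> lists A \<Longrightarrow>
    word_cong A R (p @ u @ q) (p @ v @ q)"

definition word_class :: "'l set \<Rightarrow> ('l list \<times> 'l list) set \<Rightarrow> 'l list \<Rightarrow> 'l list set" where
  "word_class A R w = {v. word_cong A R w v}"

definition presented :: "'l set \<Rightarrow> ('l list \<times> 'l list) set \<Rightarrow> 'l list set monoid" where
  "presented A R = \<lparr>
     carrier = word_class A R ` lists A,
     mult = (\<lambda>U V. \<Union>u\<in>U. \<Union>v\<in>V. word_class A R (u @ v)),
     one = word_class A R []\<rparr>"

text \<open>In \<open>free_group\<close>, the letter \<open>(i, True)\<close> stands for \<open>X\<^sub>i\<close> and \<open>(i, False)\<close> for its inverse.\<close>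

definition free_group_rels :: "(('n \<times> bool) list \<times> ('n \<times> bool) list) set" where
  "free_group_rels = {([(i, b), (i, \<not> b)], []) | i b. True}"

definition free_group :: "('n \<times> bool) list set monoid" where
  "free_group = presented UNIV free_group_rels"

definition free_gen :: "'n \<Rightarrow> ('n \<times> bool) list set" where
  "free_gen i = word_class UNIV free_group_rels [(i, True)]"

definition free_product_letters ::
    "('a, 'c) monoid_scheme \<Rightarrow> ('b, 'd) monoid_scheme \<Rightarrow> ('a + 'b) set" where
  "free_product_letters G H = Inl ` carrier G \<union> Inr ` carrier H"

definition free_product_rels ::
    "('a, 'c) monoid_scheme \<Rightarrow> ('b, 'd) monoid_scheme \<Rightarrow> (('a + 'b) list \<times> ('a + 'b) list) set" where
  "free_product_rels G H =
     {([Inl \<one>\<^bsub>G\<^esub>], []), ([Inr \<one>\<^bsub>H\<^esub>], [])} \<union>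
     {([Inl x, Inl y], [Inl (x \<otimes>\<^bsub>G\<^esub> y)]) | x y. x \<in> carrier G \<and> y \<in> carrier G} \<union>
     {([Inr x, Inr y], [Inr (x \<otimes>\<^bsub>H\<^esub> y)]) | x y. x \<in> carrier H \<and> y \<in> carrier H}"

definition free_product ::
    "('a, 'c) monoid_scheme \<Rightarrow> ('b, 'd) monoid_scheme \<Rightarrow> ('a + 'b) list set monoid" where
  "free_product G H = presented (free_product_letters G H) (free_product_rels G H)"

definition free_product_inl ::
    "('a, 'c) monoid_scheme \<Rightarrow> ('b, 'd) monoid_scheme \<Rightarrow> 'a \<Rightarrow> ('a + 'b) list set" where
  "free_product_inl G H x = word_class (free_product_letters G H) (free_product_rels G H) [Inl x]"

definition free_product_inr ::
    "('a, 'c) monoid_scheme \<Rightarrow> ('b, 'd) monoid_scheme \<Rightarrow> 'b \<Rightarrow> ('a + 'b) list set" where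
  "free_product_inr G H y = word_class (free_product_letters G H) (free_product_rels G H) [Inr y]"


section \<open>Algebraic sets\<close>

definition equation_group ::
    "('a, 'b) monoid_scheme \<Rightarrow> 'n itself \<Rightarrow> ('a + ('n \<times> bool) list set) list set monoid" where
  "equation_group G _ = free_product G (free_group :: ('n \<times> bool) list set monoid)"

text \<open>
  \<open>is_substitution G x \<phi>\<close>: \<open>\<phi>\<close> is the homomorphism from \<open>G * F\<^sub>n\<close> to \<open>G\<close> that is the identity on \<open>G\<close>
  and sends \<open>X\<^sub>i\<close> to \<open>x\<^sub>i\<close>. It exists and is unique by the two lemmas at the end of this section
  (unique on the carrier; HOL functions are arbitrary elsewhere).
\<close>

definition is_substitution ::
    "('a, 'b) monoid_scheme \<Rightarrow> 'a^'n::finite \<Rightarrow>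
       (('a + ('n \<times> bool) list set) list set \<Rightarrow> 'a) \<Rightarrow> bool" where
  "is_substitution G x \<phi> \<longleftrightarrow>
     \<phi> \<in> hom (equation_group G TYPE('n)) G \<and>
     (\<forall>g\<in>carrier G. \<phi> (free_product_inl G (free_group :: ('n \<times> bool) list set monoid) g) = g) \<and>
     (\<forall>i. \<phi> (free_product_inr G free_group (free_gen i)) = x $ i)"

definition solution_set ::
    "('a, 'b) monoid_scheme \<Rightarrow> ('a + ('n::finite \<times> bool) list set) list set set \<Rightarrow> ('a^'n) set" where
  "solution_set G W =
     {x. (\<forall>i. x $ i \<in> carrier G) \<and> (\<exists>\<phi>. is_substitution G x \<phi> \<and> (\<forall>w\<in>W. \<phi> w = \<one>\<^bsub>G\<^esub>))}"

definition algebraic_set :: "('a, 'b) monoid_scheme \<Rightarrow> ('a^'n::finite) set \<Rightarrow> bool" where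
  "algebraic_set G V \<longleftrightarrow>
     (\<exists>W. finite W \<and> W \<subseteq> carrier (equation_group G TYPE('n)) \<and> V = solution_set G W)"

lemma word_cong_lists: "word_cong A R u v \<Longrightarrow> u \<in> lists A \<and> v \<in> lists A"
  by (induction rule: word_cong.induct) auto

lemma word_cong_append_left:
  "word_cong A R u v \<Longrightarrow> p \<in> lists A \<Longrightarrow> word_cong A R (p @ u) (p @ v)"
proof (induction rule: word_cong.induct)
  case (rel u v p' q)
  then show ?case using word_cong.rel[of u v R A "p @ p'" q] by auto
next
  case (refl w)
  then show ?case by (intro word_cong.refl) auto
qed (auto intro: word_cong.sym word_cong.trans)

lemma word_cong_append_right:
  "word_cong A R u v \<Longrightarrow> q \<in> lists A \<Longrightarrow> word_cong A R (u @ q) (v @ q)"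
proof (induction rule: word_cong.induct)
  case (rel u v p q')
  then show ?case using word_cong.rel[of u v R A p "q' @ q"] by auto
next
  case (refl w)
  then show ?case by (intro word_cong.refl) auto
qed (auto intro: word_cong.sym word_cong.trans)

lemma word_class_eq_iff:
  assumes "u \<in> lists A"
  shows "word_class A R u = word_class A R v \<longleftrightarrow> word_cong A R u v"
proof
  assume "word_class A R u = word_class A R v"
  then have "word_cong A R v u"
    using word_cong.refl[OF assms, of R] unfolding word_class_def by blast
  then show "word_cong A R u v" by (rule word_cong.sym)
next
  assume "word_cong A R u v"
  then show "word_class A R u = word_class A R v"
    unfolding word_class_def by (blast intro: word_cong.sym word_cong.trans)
qed

lemma presented_mult:
  assumes "u \<in> lists A" "v \<in> lists A"
  shows "word_class A R u \<otimes>\<^bsub>presented A R\<^esub> word_class A R v = word_class A R (u @ v)"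
proof -
  have "word_class A R (u' @ v') = word_class A R (u @ v)"
    if "word_cong A R u u'" "word_cong A R v v'" for u' v'
  proof -
    have "word_cong A R (u @ v) (u @ v')" "word_cong A R (u @ v') (u' @ v')"
      using that assms word_cong_lists
      by (metis word_cong_append_left, metis word_cong_append_right)
    then have "word_cong A R (u @ v) (u' @ v')" by (rule word_cong.trans)
    then show ?thesis using assms by (subst eq_commute) (simp add: word_class_eq_iff)
  qed
  then have "word_class A R u \<otimes>\<^bsub>presented A R\<^esub> word_class A R v =
      (\<Union>u'\<in>word_class A R u. \<Union>v'\<in>word_class A R v. word_class A R (u @ v))"
    by (auto simp: presented_def word_class_def)
  also have "\<dots> = word_class A R (u @ v)"
    using assms word_cong.refl[of u A R] word_cong.refl[of v A R] by (auto simp: word_class_def)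
  finally show ?thesis .
qed

lemma presented_monoid: "monoid (presented A R)"
proof -
  have carrier: "carrier (presented A R) = word_class A R ` lists A"
    and one: "\<one>\<^bsub>presented A R\<^esub> = word_class A R []"
    by (simp_all add: presented_def)
  show ?thesis
  proof (rule monoidI, unfold carrier one)
    fix x y z assume "x \<in> word_class A R ` lists A" "y \<in> word_class A R ` lists A"
      "z \<in> word_class A R ` lists A"
    then obtain u v w where "x = word_class A R u" "y = word_class A R v" "z = word_class A R w"
      "u \<in> lists A" "v \<in> lists A" "w \<in> lists A" by blast
    moreover from this have "u @ v \<in> lists A" "v @ w \<in> lists A"
      by (simp_all only: append_in_lists_conv simp_thms)
    ultimately show "x \<otimes>\<^bsub>presented A R\<^esub> y \<otimes>\<^bsub>presented A R\<^esub> z =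
        x \<otimes>\<^bsub>presented A R\<^esub> (y \<otimes>\<^bsub>presented A R\<^esub> z)"
      by (simp only: presented_mult append_assoc)
  next
    fix x y assume "x \<in> word_class A R ` lists A" "y \<in> word_class A R ` lists A"
    then obtain u v where "x = word_class A R u" "y = word_class A R v"
      "u \<in> lists A" "v \<in> lists A" by blast
    moreover from this have "u @ v \<in> lists A"
      by (simp only: append_in_lists_conv simp_thms)
    ultimately show "x \<otimes>\<^bsub>presented A R\<^esub> y \<in> word_class A R ` lists A"
      by (simp only: presented_mult imageI)
  next
    show "word_class A R [] \<in> word_class A R ` lists A" by auto
  next
    fix x assume "x \<in> word_class A R ` lists A"
    then obtain u where "x = word_class A R u" "u \<in> lists A" by blast
    then show "word_class A R [] \<otimes>\<^bsub>presented A R\<^esub> x = x"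
      "x \<otimes>\<^bsub>presented A R\<^esub> word_class A R [] = x"
      by (simp_all only: presented_mult lists.Nil append_Nil append_Nil2)
  qed
qed

lemma presented_group:
  assumes "\<And>a. a \<in> A \<Longrightarrow> \<exists>b\<in>A. word_cong A R [b, a] []"
  shows "group (presented A R)"
proof -
  interpret monoid "presented A R" by (rule presented_monoid)
  have "\<exists>y\<in>lists A. word_cong A R (y @ w) []" if "w \<in> lists A" for w
    using that
  proof (induction w rule: lists.induct)
    case Nil
    then show ?case by (auto intro: word_cong.refl)
  next
    case (Cons a w)
    then obtain y b where y: "y \<in> lists A" "word_cong A R (y @ w) []"
      and b: "b \<in> A" "word_cong A R [b, a] []"
      using assms by blast
    have "word_cong A R ((y @ [b, a]) @ w) ((y @ []) @ w)"
      using b y Cons by (intro word_cong_append_left word_cong_append_right) auto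
    then have "word_cong A R ((y @ [b]) @ a # w) []"
      using y word_cong.trans by fastforce
    then show ?case using y b by (intro bexI[of _ "y @ [b]"]) auto
  qed
  note * = this
  show ?thesis
  proof (rule group_l_invI)
    fix x assume "x \<in> carrier (presented A R)"
    then obtain w where w: "w \<in> lists A" "x = word_class A R w" by (auto simp: presented_def)
    obtain y where y: "y \<in> lists A" "word_cong A R (y @ w) []" using *[OF w(1)] by blast
    then have "word_class A R y \<otimes>\<^bsub>presented A R\<^esub> x = word_class A R []"
      using w by (simp add: presented_mult word_class_eq_iff)
    then show "\<exists>y\<in>carrier (presented A R). y \<otimes>\<^bsub>presented A R\<^esub> x = \<one>\<^bsub>presented A R\<^esub>"
      using y by (auto simp: presented_def)
  qed
qed

lemma free_group_group: "group free_group"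
  unfolding free_group_def
proof (rule presented_group)
  fix a :: "'n \<times> bool"
  obtain i b where a: "a = (i, b)" by force
  have "([(i, \<not> b), a], []) \<in> free_group_rels" by (auto simp: free_group_rels_def a)
  from word_cong.rel[OF this, of UNIV "[]" "[]"]
  show "\<exists>b\<in>UNIV. word_cong UNIV free_group_rels [b, a] []" by auto
qed

lemma free_product_group:
  assumes "group G" "group H"
  shows "group (free_product G H)"
  unfolding free_product_def
proof (rule presented_group)
  let ?A = "free_product_letters G H" and ?R = "free_product_rels G H"
  interpret G: group G by fact
  interpret H: group H by fact
  fix a assume "a \<in> ?A"
  then consider x where "a = Inl x" "x \<in> carrier G" | x where "a = Inr x" "x \<in> carrier H"
    by (auto simp: free_product_letters_def)
  then show "\<exists>b\<in>?A. word_cong ?A ?R [b, a] []"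
  proof cases
    case 1
    have "([Inl (inv\<^bsub>G\<^esub> x), a], [Inl (inv\<^bsub>G\<^esub> x \<otimes>\<^bsub>G\<^esub> x)]) \<in> ?R" "([Inl \<one>\<^bsub>G\<^esub>], []) \<in> ?R"
      using 1 unfolding free_product_rels_def by blast+
    from this[THEN word_cong.rel, of ?A "[]" "[]"] 1
    have "word_cong ?A ?R [Inl (inv\<^bsub>G\<^esub> x), a] [Inl \<one>\<^bsub>G\<^esub>]" "word_cong ?A ?R [Inl \<one>\<^bsub>G\<^esub>] []"
      by (auto simp: free_product_letters_def)
    then have "word_cong ?A ?R [Inl (inv\<^bsub>G\<^esub> x), a] []" by (rule word_cong.trans)
    then show ?thesis using 1 by (auto simp: free_product_letters_def)
  next
    case 2
    have "([Inr (inv\<^bsub>H\<^esub> x), a], [Inr (inv\<^bsub>H\<^esub> x \<otimes>\<^bsub>H\<^esub> x)]) \<in> ?R" "([Inr \<one>\<^bsub>H\<^esub>], []) \<in> ?R"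
      using 2 unfolding free_product_rels_def by blast+
    from this[THEN word_cong.rel, of ?A "[]" "[]"] 2
    have "word_cong ?A ?R [Inr (inv\<^bsub>H\<^esub> x), a] [Inr \<one>\<^bsub>H\<^esub>]" "word_cong ?A ?R [Inr \<one>\<^bsub>H\<^esub>] []"
      by (auto simp: free_product_letters_def)
    then have "word_cong ?A ?R [Inr (inv\<^bsub>H\<^esub> x), a] []" by (rule word_cong.trans)
    then show ?thesis using 2 by (auto simp: free_product_letters_def)
  qed
qed

definition word_eval :: "('a, 'b) monoid_scheme \<Rightarrow> ('l \<Rightarrow> 'a) \<Rightarrow> 'l list \<Rightarrow> 'a" where
  "word_eval G f w = foldr (\<lambda>s g. f s \<otimes>\<^bsub>G\<^esub> g) w \<one>\<^bsub>G\<^esub>"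

lemma word_eval_simps [simp]:
  "word_eval G f [] = \<one>\<^bsub>G\<^esub>" "word_eval G f (a # w) = f a \<otimes>\<^bsub>G\<^esub> word_eval G f w"
  by (simp_all add: word_eval_def)

context group
begin

lemma word_eval_closed [simp]:
  "f \<in> A \<rightarrow> carrier G \<Longrightarrow> w \<in> lists A \<Longrightarrow> word_eval G f w \<in> carrier G"
  by (induction w) auto

lemma word_eval_append:
  "f \<in> A \<rightarrow> carrier G \<Longrightarrow> u \<in> lists A \<Longrightarrow> v \<in> lists A \<Longrightarrow>
     word_eval G f (u @ v) = word_eval G f u \<otimes> word_eval G f v"
proof (induction u)
  case (Cons a u)
  then have "f a \<in> carrier G" "word_eval G f u \<in> carrier G" "word_eval G f v \<in> carrier G"
    by auto
  with Cons show ?case by (simp add: m_assoc)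
qed auto

lemma word_eval_cong:
  assumes f: "f \<in> A \<rightarrow> carrier G"
    and R: "\<And>u v. (u, v) \<in> R \<Longrightarrow> u \<in> lists A \<Longrightarrow> v \<in> lists A \<Longrightarrow>
      word_eval G f u = word_eval G f v"
  shows "word_cong A R u v \<Longrightarrow> word_eval G f u = word_eval G f v"
proof (induction rule: word_cong.induct)
  case (rel u v p q)
  then show ?case using R[of u v] by (simp add: word_eval_append[OF f])
qed auto

lemma presented_hom_exists:
  assumes f: "f \<in> A \<rightarrow> carrier G"
    and R: "\<And>u v. (u, v) \<in> R \<Longrightarrow> u \<in> lists A \<Longrightarrow> v \<in> lists A \<Longrightarrow>
      word_eval G f u = word_eval G f v"
  obtains \<phi> where "\<phi> \<in> hom (presented A R) G"
    "\<And>a. a \<in> A \<Longrightarrow> \<phi> (word_class A R [a]) = f a"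
proof -
  define \<phi> where "\<phi> U = word_eval G f (SOME u. u \<in> U)" for U
  have \<phi>: "\<phi> (word_class A R w) = word_eval G f w" if "w \<in> lists A" for w
  proof -
    have "(SOME u. u \<in> word_class A R w) \<in> word_class A R w"
      by (rule someI[of _ w]) (simp add: word_class_def word_cong.refl that)
    then have "word_cong A R w (SOME u. u \<in> word_class A R w)"
      by (simp add: word_class_def)
    then show ?thesis unfolding \<phi>_def using word_eval_cong[OF f R] by metis
  qed
  show thesis
  proof
    show "\<phi> \<in> hom (presented A R) G"
    proof (rule homI)
      fix x assume "x \<in> carrier (presented A R)"
      then obtain w where "w \<in> lists A" "x = word_class A R w" by (auto simp: presented_def)
      then show "\<phi> x \<in> carrier G" using \<phi> word_eval_closed[OF f] by metis
    next
      fix x y assume "x \<in> carrier (presented A R)" "y \<in> carrier (presented A R)"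
      then obtain u v where "u \<in> lists A" "v \<in> lists A" "x = word_class A R u" "y = word_class A R v"
        by (auto simp: presented_def)
      then show "\<phi> (x \<otimes>\<^bsub>presented A R\<^esub> y) = \<phi> x \<otimes> \<phi> y"
        by (simp add: presented_mult \<phi> word_eval_append[OF f])
    qed
    show "\<phi> (word_class A R [a]) = f a" if "a \<in> A" for a
    proof -
      have "f a \<in> carrier G" using f that by auto
      then show ?thesis using that by (simp add: \<phi>)
    qed
  qed
qed

lemma presented_hom_unique:
  assumes "group (presented A R)"
    and "\<phi> \<in> hom (presented A R) G" "\<psi> \<in> hom (presented A R) G"
    and "\<And>a. a \<in> A \<Longrightarrow> \<phi> (word_class A R [a]) = \<psi> (word_class A R [a])"
    and "x \<in> carrier (presented A R)"
  shows "\<phi> x = \<psi> x"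
proof -
  have one: "\<phi> (word_class A R []) = \<one>" "\<psi> (word_class A R []) = \<one>"
    using hom_one[OF assms(2) assms(1)] hom_one[OF assms(3) assms(1)] is_group
    by (simp_all add: presented_def)
  have "\<phi> (word_class A R w) = \<psi> (word_class A R w)" if "w \<in> lists A" for w
    using that
  proof (induction w rule: lists.induct)
    case (Cons a w)
    have cl: "word_class A R [a] \<in> carrier (presented A R)"
      "word_class A R w \<in> carrier (presented A R)"
      using Cons by (auto simp: presented_def)
    have eq: "word_class A R (a # w) = word_class A R [a] \<otimes>\<^bsub>presented A R\<^esub> word_class A R w"
      using Cons by (simp add: presented_mult)
    show ?case
      unfolding eq hom_mult[OF assms(2) cl] hom_mult[OF assms(3) cl]
      using Cons assms(4) by simp
  qed (simp add: one)
  then show ?thesis using assms(5) by (auto simp: presented_def)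
qed

lemma free_product_inr_hom:
  "group H \<Longrightarrow> free_product_inr G H \<in> hom H (free_product G H)"
proof (rule homI)
  fix x y assume "group H" and xy: "x \<in> carrier H" "y \<in> carrier H"
  then interpret H: group H by simp
  let ?A = "free_product_letters G H" and ?R = "free_product_rels G H"
  have "([Inr x, Inr y], [Inr (x \<otimes>\<^bsub>H\<^esub> y)]) \<in> ?R"
    using xy unfolding free_product_rels_def by blast
  from word_cong.rel[OF this, of ?A "[]" "[]"] xy
  have "word_cong ?A ?R [Inr x, Inr y] [Inr (x \<otimes>\<^bsub>H\<^esub> y)]"
    by (auto simp: free_product_letters_def)
  then show "free_product_inr G H (x \<otimes>\<^bsub>H\<^esub> y) =
      free_product_inr G H x \<otimes>\<^bsub>free_product G H\<^esub> free_product_inr G H y"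
    using xy by (auto simp: free_product_inr_def free_product_def presented_mult
        free_product_letters_def word_class_eq_iff intro!: word_cong.sym)
qed (auto simp: free_product_inr_def free_product_def presented_def free_product_letters_def)

lemma is_substitution_exists:
  fixes x :: "'a^'n::finite"
  assumes x: "\<And>i. x $ i \<in> carrier G"
  shows "\<exists>\<phi>. is_substitution G x \<phi>"
proof -
  define f where "f = (\<lambda>(i :: 'n, b). if b then x $ i else inv (x $ i))"
  have "f \<in> UNIV \<rightarrow> carrier G" using x by (auto simp: f_def)
  moreover have "word_eval G f u = word_eval G f v" if "(u, v) \<in> free_group_rels" for u v
    using that x by (auto simp: free_group_rels_def f_def)
  ultimately obtain \<phi> where \<phi>: "\<phi> \<in> hom free_group G"
    "\<And>a. \<phi> (word_class UNIV free_group_rels [a]) = f a"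
    using presented_hom_exists[of f UNIV free_group_rels] unfolding free_group_def
    by (metis UNIV_I)
  have one: "\<phi> \<one>\<^bsub>free_group\<^esub> = \<one>"
    using hom_one[OF \<phi>(1) free_group_group is_group] .
  let ?H = "free_group :: ('n \<times> bool) list set monoid"
  define h where "h = case_sum (\<lambda>g. g) \<phi>"
  have "h \<in> free_product_letters G ?H \<rightarrow> carrier G"
    using \<phi>(1) by (auto simp: h_def free_product_letters_def hom_def)
  moreover have "word_eval G h u = word_eval G h v" if "(u, v) \<in> free_product_rels G ?H" for u v
    using that hom_in_carrier[OF \<phi>(1)] hom_mult[OF \<phi>(1)]
    by (auto simp: free_product_rels_def h_def one)
  ultimately obtain \<psi> where \<psi>: "\<psi> \<in> hom (free_product G ?H) G"
    "\<And>a. a \<in> free_product_letters G ?H \<Longrightarrow>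
       \<psi> (word_class (free_product_letters G ?H) (free_product_rels G ?H) [a]) = h a"
    using presented_hom_exists[of h "free_product_letters G ?H" "free_product_rels G ?H"]
    unfolding free_product_def by metis
  have "is_substitution G x \<psi>"
    unfolding is_substitution_def equation_group_def free_product_inl_def free_product_inr_def
  proof (intro conjI ballI allI)
    fix i :: 'n
    have "free_gen i \<in> carrier ?H" by (simp add: free_gen_def free_group_def presented_def)
    then show "\<psi> (word_class (free_product_letters G ?H) (free_product_rels G ?H)
        [Inr (free_gen i)]) = x $ i"
      by (subst \<psi>(2)) (auto simp: free_product_letters_def h_def free_gen_def \<phi>(2) f_def)
  qed (use \<psi> in \<open>auto simp: h_def free_product_letters_def\<close>)
  then show ?thesis by blast
qed

lemma is_substitution_unique:
  fixes x :: "'a^'n::finite"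
  assumes "is_substitution G x \<phi>" "is_substitution G x \<psi>"
    and w: "w \<in> carrier (equation_group G TYPE('n))"
  shows "\<phi> w = \<psi> w"
proof -
  let ?H = "free_group :: ('n \<times> bool) list set monoid"
  interpret H: group ?H by (rule free_group_group)
  have P: "group (free_product G ?H)"
    by (intro free_product_group is_group free_group_group)
  note hom = assms(1,2)[unfolded is_substitution_def equation_group_def]
  have inr: "free_product_inr G ?H \<in> hom ?H (free_product G ?H)"
    by (intro free_product_inr_hom free_group_group)
  define \<alpha> \<beta> where "\<alpha> = \<phi> \<circ> free_product_inr G ?H" and "\<beta> = \<psi> \<circ> free_product_inr G ?H"
  have ab: "\<alpha> \<in> hom ?H G" "\<beta> \<in> hom ?H G"
    using hom inr unfolding \<alpha>_def \<beta>_def by (auto intro: Group.hom_compose)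
  have gen: "\<alpha> (free_gen i) = \<beta> (free_gen i)" for i
    using hom by (simp add: \<alpha>_def \<beta>_def)
  have fg: "free_gen i \<in> carrier ?H" for i
    by (simp add: free_gen_def free_group_def presented_def)
  have inv: "word_class UNIV free_group_rels [(i, False)] = inv\<^bsub>?H\<^esub> (free_gen i)" for i :: 'n
  proof (rule H.inv_equality[symmetric])
    have "([(i, False), (i, True)], []) \<in> free_group_rels" by (auto simp: free_group_rels_def)
    from word_cong.rel[OF this, of UNIV "[]" "[]"]
    show "word_class UNIV free_group_rels [(i, False)] \<otimes>\<^bsub>?H\<^esub> free_gen i = \<one>\<^bsub>?H\<^esub>"
      by (simp add: free_gen_def free_group_def presented_mult word_class_eq_iff)
         (simp add: presented_def word_class_eq_iff)
  qed (auto simp: free_gen_def free_group_def presented_def)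
  have ab_inv: "\<gamma> (inv\<^bsub>?H\<^esub> y) = inv (\<gamma> y)" if "\<gamma> \<in> hom ?H G" "y \<in> carrier ?H" for \<gamma> y
    using that group_hom.hom_inv[of ?H G \<gamma> y] is_group free_group_group
    by (simp add: group_hom_def group_hom_axioms_def)
  have letters: "\<alpha> (word_class UNIV free_group_rels [a]) = \<beta> (word_class UNIV free_group_rels [a])"
    for a :: "'n \<times> bool"
  proof (cases a)
    case (Pair i b)
    then show ?thesis
      using gen[of i] fg[of i] inv[of i] ab_inv[OF ab(1)] ab_inv[OF ab(2)]
      by (cases b) (auto simp: free_gen_def)
  qed
  have eqH: "\<alpha> y = \<beta> y" if "y \<in> carrier ?H" for y
    using that ab letters H.is_group
      presented_hom_unique[of UNIV "free_group_rels :: (('n \<times> bool) list \<times> _) set" \<alpha> \<beta> y]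
    unfolding free_group_def by blast
  show ?thesis
  proof (rule presented_hom_unique)
    show "group (presented (free_product_letters G ?H) (free_product_rels G ?H))"
      using P by (simp add: free_product_def)
    show "\<phi> (word_class (free_product_letters G ?H) (free_product_rels G ?H) [a]) =
        \<psi> (word_class (free_product_letters G ?H) (free_product_rels G ?H) [a])"
      if "a \<in> free_product_letters G ?H" for a
      using that hom eqH
      by (auto simp: free_product_letters_def free_product_inl_def free_product_inr_def \<alpha>_def \<beta>_def)
  qed (use hom w in \<open>auto simp: free_product_def equation_group_def\<close>)
qed

end


section \<open>Growth series\<close>

text \<open>\<open>S\<close> generates in the sense that every element is a product of letters of \<open>S\<close> (no inverses).\<close>

definition word_generates :: "('a, 'b) monoid_scheme \<Rightarrow> 'a set \<Rightarrow> bool" where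
  "word_generates G S \<longleftrightarrow>
     S \<subseteq> carrier G \<and> (\<forall>g\<in>carrier G. \<exists>w\<in>lists S. word_eval G (\<lambda>s. s) w = g)"

definition word_weight :: "('a \<Rightarrow> nat) \<Rightarrow> 'a list \<Rightarrow> nat" where
  "word_weight \<omega> w = sum_list (map \<omega> w)"

definition elem_weight :: "('a, 'b) monoid_scheme \<Rightarrow> 'a set \<Rightarrow> ('a \<Rightarrow> nat) \<Rightarrow> 'a \<Rightarrow> nat" where
  "elem_weight G S \<omega> g =
     (LEAST k. \<exists>w\<in>lists S. word_eval G (\<lambda>s. s) w = g \<and> word_weight \<omega> w = k)"

text \<open>
  The sum over \<open>x \<in> V\<close> of the monomials whose exponent of \<open>z\<^sub>i\<close> is the weight of \<open>x $ i\<close>, collected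
  by exponent. The sets counted are finite by \<open>finite_elem_weight_vec\<close>.
\<close>

definition growth_series ::
    "('a, 'b) monoid_scheme \<Rightarrow> 'a set \<Rightarrow> ('a \<Rightarrow> nat) \<Rightarrow> ('a^'n::finite) set \<Rightarrow>
       ('c::comm_ring_1, 'n) mfps" where
  "growth_series G S \<omega> V =
     Mfps (\<lambda>m. of_nat (card {x\<in>V. \<forall>i. elem_weight G S \<omega> (x $ i) = m $ i}))"

lemma finite_elem_weight:
  assumes "finite S" "word_generates G S" "\<forall>s\<in>S. \<omega> s > 0"
  shows "finite {g\<in>carrier G. elem_weight G S \<omega> g = k}"
proof -
  have len: "length w \<le> word_weight \<omega> w" if "w \<in> lists S" for w
    using that
  proof (induction w)
    case (Cons a w)
    then have "\<omega> a > 0" using assms(3) by auto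
    with Cons show ?case by (auto simp: word_weight_def)
  qed (simp add: word_weight_def)
  have "{g\<in>carrier G. elem_weight G S \<omega> g = k} \<subseteq>
      word_eval G (\<lambda>s. s) ` {w. set w \<subseteq> S \<and> length w \<le> k}"
  proof clarify
    fix g assume g: "g \<in> carrier G" "k = elem_weight G S \<omega> g"
    then have "\<exists>k. \<exists>w\<in>lists S. word_eval G (\<lambda>s. s) w = g \<and> word_weight \<omega> w = k"
      using assms(2) unfolding word_generates_def by blast
    from LeastI_ex[OF this]
    obtain w where "w \<in> lists S" "word_eval G (\<lambda>s. s) w = g" "word_weight \<omega> w = elem_weight G S \<omega> g"
      unfolding elem_weight_def by blast
    then show "g \<in> word_eval G (\<lambda>s. s) ` {w. set w \<subseteq> S \<and> length w \<le> elem_weight G S \<omega> g}"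
      using len[of w] by auto
  qed
  then show ?thesis
    by (rule finite_subset) (intro finite_imageI finite_lists_length_le assms)
qed

lemma finite_elem_weight_vec:
  fixes V :: "('a^'n::finite) set"
  assumes "finite S" "word_generates G S" "\<forall>s\<in>S. \<omega> s > 0"
    and "\<forall>x\<in>V. \<forall>i. x $ i \<in> carrier G"
  shows "finite {x\<in>V. \<forall>i. elem_weight G S \<omega> (x $ i) = m $ i}"
proof -
  let ?P = "PiE UNIV (\<lambda>i. {g\<in>carrier G. elem_weight G S \<omega> g = m $ i})"
  have "{x\<in>V. \<forall>i. elem_weight G S \<omega> (x $ i) = m $ i} \<subseteq> vec_lambda ` ?P"
  proof clarify
    fix x assume "x \<in> V" "\<forall>i. elem_weight G S \<omega> (x $ i) = m $ i"
    then have "vec_nth x \<in> ?P" using assms(4) by auto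
    then have "vec_lambda (vec_nth x) \<in> vec_lambda ` ?P" by (rule imageI)
    then show "x \<in> vec_lambda ` ?P" by simp
  qed
  moreover have "finite (vec_lambda ` ?P)"
    using finite_elem_weight[OF assms(1-3)] by (intro finite_imageI finite_PiE) simp_all
  ultimately show ?thesis by (rule finite_subset)
qed


section \<open>Virtually abelian groups\<close>

definition finitely_generated :: "('a, 'b) monoid_scheme \<Rightarrow> bool" where
  "finitely_generated G \<longleftrightarrow> (\<exists>A. finite A \<and> A \<subseteq> carrier G \<and> generate G A = carrier G)"

definition virtually_abelian :: "('a, 'b) monoid_scheme \<Rightarrow> bool" where
  "virtually_abelian G \<longleftrightarrow>
     (\<exists>H. subgroup H G \<and> finite (rcosets\<^bsub>G\<^esub> H) \<and> comm_group (G\<lparr>carrier := H\<rparr>))"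

end

theory Submission
  imports
    Defs
    "HOL-Library.Multiset_Order"
    "HOL-Library.Disjoint_Sets"
    "HOL-Algebra.FiniteProduct"
begin

text \<open>
  The growth series is in fact a rational function, and rational functions are holonomic
  (\<open>mfps_rational_imp_holonomic\<close>).

  Let \<open>A\<close> be an abelian normal subgroup of finite index. A word in the generators is a walk in the
  Schreier graph of \<open>G\<close> modulo \<open>A\<close>. Label each edge by the element of \<open>A\<close> that corrects the coset
  representatives along it. Then the value of a word depends only on the last vertex and on how often
  each edge is used, and apart from the last vertex it is a monoid homomorphism from edge
  multiplicities to \<open>A\<close>. The weight is additive as well. By Euler's argument on closed walks, the
  multiplicity vectors of walks with given end points and a given set of used edges are
  translation-closed: if \<open>x\<close>, \<open>x + d\<close> and \<open>y\<close> occur, so does \<open>y + d\<close>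
  (\<open>walks_translation_closed\<close>). An algebraic set is translation-closed in the same sense with
  respect to left multiplication by \<open>A\<^sup>n\<close> within each class of tuples congruent modulo \<open>A\<close>, because
  multiplying the variables by given elements of \<open>A\<close> multiplies the value of an equation by an
  element of \<open>A\<close> that is the same for all tuples in the class (\<open>solution_set_lockstep\<close>).

  So the set of pairs \<open>(x, m)\<close> with \<open>x \<in> V\<close> such that each \<open>x $ i\<close> is the value of a word of weight
  \<open>m $ i\<close> is a finite union of images of translation-closed sets under affine maps (\<open>words_rational\<close>).
  With an additional letter of weight one for the unit, this set consists of the \<open>x \<in> V\<close> together with
  all upper bounds for their weights, and its series is the growth series times the product of the
  \<open>1 / (1 - z\<^sub>i)\<close> (\<open>slack_rational\<close>). In this way the minimum over words never has to be described.

  It remains to count the points of a union of affine images, each point once. Intersections of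
  affine images of translation-closed sets are again of this form (\<open>piece_Inter\<close>), so by
  inclusion-exclusion a single image is enough. There Dickson's lemma gives finitely many generators;
  choosing for each point the least parameter with respect to a well-order compatible with addition
  leaves down-closed sets of exponent vectors (\<open>piece_rational\<close>), and their series are rational
  (\<open>down_closed_rational\<close>), like Hilbert series of monomial ideals.
\<close>

section \<open>Rational power series are holonomic\<close>

lemma mfps_nth_add [simp]: "mfps_nth (f + g) m = mfps_nth f m + mfps_nth g m"
  by (simp add: plus_mfps_def)

lemma mfps_nth_diff [simp]: "mfps_nth (f - g) m = mfps_nth f m - mfps_nth g m"
  by (simp add: minus_mfps_def)

lemma mfps_nth_one: "mfps_nth 1 m = (if m = 0 then 1 else 0)"
  by (simp add: one_mfps_def)

definition mfps_monom :: "nat^'n::finite \<Rightarrow> ('a::comm_ring_1, 'n) mfps" where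
  "mfps_monom a = Mfps (\<lambda>m. if m = a then 1 else 0)"

lemma mfps_nth_monom_mult_add: "mfps_nth (mfps_monom a * f) (m + a) = mfps_nth f m"
proof -
  have "mfps_nth (mfps_monom a * f) (m + a) =
      (\<Sum>x\<in>splits (m + a). if x = (a, m) then mfps_nth f m else 0)"
    unfolding mfps_nth_mult mfps_monom_def
    by (rule sum.cong) (auto simp: splits_def add.commute[of a] split: if_splits)
  also have "\<dots> = mfps_nth f m"
    by (subst sum.delta) (simp_all, simp add: splits_def add.commute)
  finally show ?thesis .
qed

lemma mfps_nth_monom_mult_eq_0:
  assumes "\<And>k. m \<noteq> k + a"
  shows "mfps_nth (mfps_monom a * f) m = 0"
  unfolding mfps_nth_mult mfps_monom_def
  by (rule sum.neutral) (use assms in \<open>auto simp: splits_def add.commute\<close>)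

lemma mfps_polynomial_monom [simp]: "mfps_polynomial (mfps_monom a)"
  by (auto simp: mfps_polynomial_def mfps_monom_def intro: finite_subset[of _ "{a}"])

lemma mfps_polynomial_0 [simp]: "mfps_polynomial 0"
  by (simp add: mfps_polynomial_def)

lemma mfps_monom_0: "mfps_monom 0 = 1"
  by (simp add: mfps_monom_def one_mfps_def)

lemma mfps_polynomial_1 [simp]: "mfps_polynomial 1"
  using mfps_polynomial_monom[of 0] by (simp add: mfps_monom_0)

lemma mfps_polynomial_add:
  assumes "mfps_polynomial f" "mfps_polynomial g"
  shows "mfps_polynomial (f + g)"
proof -
  have "{m. mfps_nth (f + g) m \<noteq> 0} \<subseteq> {m. mfps_nth f m \<noteq> 0} \<union> {m. mfps_nth g m \<noteq> 0}"
    by auto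
  then show ?thesis using assms unfolding mfps_polynomial_def
    by (meson finite_Un finite_subset)
qed

lemma mfps_polynomial_diff:
  assumes "mfps_polynomial f" "mfps_polynomial g"
  shows "mfps_polynomial (f - g)"
proof -
  have "{m. mfps_nth (f - g) m \<noteq> 0} \<subseteq> {m. mfps_nth f m \<noteq> 0} \<union> {m. mfps_nth g m \<noteq> 0}"
    by auto
  then show ?thesis using assms unfolding mfps_polynomial_def
    by (meson finite_Un finite_subset)
qed

lemma mfps_polynomial_mult:
  assumes "mfps_polynomial f" "mfps_polynomial g"
  shows "mfps_polynomial (f * g)"
proof -
  have "{m. mfps_nth (f * g) m \<noteq> 0} \<subseteq>
      (\<lambda>(p, q). p + q) ` ({m. mfps_nth f m \<noteq> 0} \<times> {m. mfps_nth g m \<noteq> 0})"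
  proof
    fix m assume "m \<in> {m. mfps_nth (f * g) m \<noteq> 0}"
    then obtain x where "x \<in> splits m" "(case x of (p, q) \<Rightarrow> mfps_nth f p * mfps_nth g q) \<noteq> 0"
      unfolding mfps_nth_mult by (auto elim: sum.not_neutral_contains_not_neutral)
    then show "m \<in> (\<lambda>(p, q). p + q) ` ({m. mfps_nth f m \<noteq> 0} \<times> {m. mfps_nth g m \<noteq> 0})"
      by (intro image_eqI[of _ _ x]) (auto simp: splits_def)
  qed
  then show ?thesis using assms unfolding mfps_polynomial_def
    by (meson finite_SigmaI finite_imageI finite_subset)
qed

lemma mfps_polynomial_pderiv:
  assumes "mfps_polynomial f"
  shows "mfps_polynomial (mfps_pderiv i f)"
proof -
  have "{m. mfps_nth (mfps_pderiv i f) m \<noteq> 0} \<subseteq> (\<lambda>m. m + axis i 1) -` {m. mfps_nth f m \<noteq> 0}"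
    by (auto simp: mfps_pderiv_def)
  moreover have "finite ((\<lambda>m. m + axis i 1) -` {m. mfps_nth f m \<noteq> 0})"
    using assms by (intro finite_vimageI) (auto simp: mfps_polynomial_def inj_def)
  ultimately show ?thesis unfolding mfps_polynomial_def by (rule finite_subset)
qed

text \<open>
  The Leibniz rule, which gives that derivatives of rational series are rational. Comparing
  coefficients at \<open>m\<close>, each splitting \<open>p + q\<close> of \<open>m + e\<close>, with \<open>e\<close> the exponent of the variable,
  counts with the factor \<open>p $ i + q $ i\<close>. The terms with factor \<open>p $ i\<close> come from a splitting of \<open>m\<close> by
  raising the first part by \<open>e\<close>, those with factor \<open>q $ i\<close> by raising the second part.
\<close>

lemma mfps_pderiv_mult: "mfps_pderiv i (f * g) = mfps_pderiv i f * g + f * mfps_pderiv i g"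
proof (rule mfps_eqI)
  fix m :: "nat^'b"
  define e where "e = (axis i 1 :: nat^'b)"
  have e: "e $ i = 1" "j \<noteq> i \<Longrightarrow> e $ j = 0" for j by (simp_all add: e_def axis_def)
  let ?L = "\<lambda>x. of_nat (fst x $ i) * (mfps_nth f (fst x) * mfps_nth g (snd x))"
  let ?R = "\<lambda>x. of_nat (snd x $ i) * (mfps_nth f (fst x) * mfps_nth g (snd x))"
  have minus_plus: "p - e + e = p" if "0 < p $ i" for p :: "nat^'b"
  proof -
    have "p $ j - e $ j + e $ j = p $ j" for j
      using that e by (cases "j = i") auto
    then show ?thesis by (simp add: vec_eq_iff)
  qed
  have minus_split: "p - e + q = m" if "0 < p $ i" "p + q = m + e" for p q
  proof -
    have "(p - e + q) + e = m + e"
      using minus_plus[OF that(1)] that(2) by (metis add.assoc add.commute)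
    then show "p - e + q = m" by simp
  qed
  have minus_split': "p + (q - e) = m" if "0 < q $ i" "p + q = m + e" for p q
    using minus_split[of q p] that by (simp add: add.commute)
  have plus_split: "p + e + q = m + e" "p + (q + e) = m + e" if "p + q = m" for p q
    using that by (auto simp: algebra_simps)
  have plus_pos: "0 < (p + e) $ i" for p by (simp add: e)
  have coeff: "mfps_nth (mfps_pderiv i h) p = of_nat ((p + e) $ i) * mfps_nth h (p + e)"
    for h :: "('a, 'b) mfps" and p
    unfolding mfps_pderiv_def e_def[symmetric] by (simp add: e)
  have "mfps_nth (mfps_pderiv i (f * g)) m = (\<Sum>x\<in>splits (m + e). ?L x + ?R x)"
    unfolding coeff mfps_nth_mult sum_distrib_left
  proof (rule sum.cong)
    fix x assume "x \<in> splits (m + e)"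
    then have "of_nat ((m + e) $ i) = (of_nat (fst x $ i) + of_nat (snd x $ i) :: 'a)"
      by (auto simp: splits_def simp flip: of_nat_add vector_add_component)
    then show "of_nat ((m + e) $ i) * (case x of (p, q) \<Rightarrow> mfps_nth f p * mfps_nth g q) = ?L x + ?R x"
      by (simp only: distrib_right split_beta)
  qed simp
  also have "\<dots> = (\<Sum>x\<in>splits (m + e). ?L x) + (\<Sum>x\<in>splits (m + e). ?R x)"
    by (rule sum.distrib)
  also have "(\<Sum>x\<in>splits (m + e). ?L x) = (\<Sum>x\<in>{x\<in>splits (m + e). fst x $ i \<noteq> 0}. ?L x)"
    by (rule sum.mono_neutral_right) auto
  also have "\<dots> = (\<Sum>(p, q)\<in>splits m. mfps_nth (mfps_pderiv i f) p * mfps_nth g q)"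
    by (rule sum.reindex_bij_witness[where i = "\<lambda>(p, q). (p + e, q)" and j = "\<lambda>(p, q). (p - e, q)"])
      (auto simp: splits_def coeff minus_plus minus_split plus_split plus_pos simp del: vector_add_component)
  also have "\<dots> = mfps_nth (mfps_pderiv i f * g) m" by (simp add: mfps_nth_mult)
  also have "(\<Sum>x\<in>splits (m + e). ?R x) = (\<Sum>x\<in>{x\<in>splits (m + e). snd x $ i \<noteq> 0}. ?R x)"
    by (rule sum.mono_neutral_right) auto
  also have "\<dots> = (\<Sum>(p, q)\<in>splits m. mfps_nth f p * mfps_nth (mfps_pderiv i g) q)"
    by (rule sum.reindex_bij_witness[where i = "\<lambda>(p, q). (p, q + e)" and j = "\<lambda>(p, q). (p, q - e)"])
      (auto simp: splits_def coeff minus_plus minus_split' plus_split plus_pos simp del: vector_add_component)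
  also have "\<dots> = mfps_nth (f * mfps_pderiv i g) m" by (simp add: mfps_nth_mult)
  finally show "mfps_nth (mfps_pderiv i (f * g)) m =
      mfps_nth (mfps_pderiv i f * g + f * mfps_pderiv i g) m" by simp
qed

text \<open>
  Denominators are cleared inside the ring of power series, so that the closure properties are
  identities in this ring; the fraction field enters only with \<^const>\<open>holonomic\<close>.
\<close>

definition mfps_rational :: "('a::idom, 'n::finite) mfps \<Rightarrow> bool" where
  "mfps_rational f \<longleftrightarrow> (\<exists>p q. mfps_polynomial p \<and> mfps_polynomial q \<and> q \<noteq> 0 \<and> q * f = p)"

lemma mfps_rationalI:
  "mfps_polynomial p \<Longrightarrow> mfps_polynomial q \<Longrightarrow> q \<noteq> 0 \<Longrightarrow> q * f = p \<Longrightarrow> mfps_rational f"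
  unfolding mfps_rational_def by blast

lemma mfps_rationalE:
  assumes "mfps_rational f"
  obtains p q where "mfps_polynomial p" "mfps_polynomial q" "q \<noteq> 0" "q * f = p"
  using assms unfolding mfps_rational_def by blast

lemma mfps_polynomial_imp_rational: "mfps_polynomial f \<Longrightarrow> mfps_rational f"
  by (rule mfps_rationalI[of f 1]) simp_all

lemma mfps_rational_add:
  assumes "mfps_rational f" "mfps_rational g"
  shows "mfps_rational (f + g)"
proof -
  obtain p q where p: "mfps_polynomial p" "mfps_polynomial q" "q \<noteq> 0" "q * f = p"
    using assms(1) by (rule mfps_rationalE)
  obtain r s where r: "mfps_polynomial r" "mfps_polynomial s" "s \<noteq> 0" "s * g = r"
    using assms(2) by (rule mfps_rationalE)
  show ?thesis
  proof (rule mfps_rationalI)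
    show "(q * s) * (f + g) = s * p + q * r"
      unfolding p(4)[symmetric] r(4)[symmetric] by (simp only: algebra_simps)
    show "mfps_polynomial (s * p + q * r)" "mfps_polynomial (q * s)"
      using p(1,2) r(1,2) by (simp_all add: mfps_polynomial_add mfps_polynomial_mult)
    show "q * s \<noteq> 0" using p(3) r(3) by simp
  qed
qed

lemma mfps_rational_poly_mult:
  assumes "mfps_polynomial h" "mfps_rational f"
  shows "mfps_rational (h * f)"
proof -
  obtain p q where p: "mfps_polynomial p" "mfps_polynomial q" "q \<noteq> 0" "q * f = p"
    using assms(2) by (rule mfps_rationalE)
  show ?thesis
  proof (rule mfps_rationalI)
    show "q * (h * f) = h * p"
      unfolding p(4)[symmetric] by (simp only: mult_ac)
    show "mfps_polynomial (h * p)" using p(1) assms(1) by (rule mfps_polynomial_mult[rotated])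
  qed (use p in simp_all)
qed

lemma mfps_rational_diff:
  assumes "mfps_rational f" "mfps_rational g"
  shows "mfps_rational (f - g)"
proof -
  have "mfps_polynomial (0 - 1 :: ('a, 'b) mfps)"
    by (rule mfps_polynomial_diff) simp_all
  from mfps_rational_add[OF assms(1) mfps_rational_poly_mult[OF this assms(2)]]
  show ?thesis by simp
qed

lemma mfps_rational_cancel:
  assumes "mfps_polynomial h" "h \<noteq> 0" "mfps_rational (h * f)"
  shows "mfps_rational f"
proof -
  obtain p q where p: "mfps_polynomial p" "mfps_polynomial q" "q \<noteq> 0" "q * (h * f) = p"
    using assms(3) by (rule mfps_rationalE)
  show ?thesis
  proof (rule mfps_rationalI)
    show "(q * h) * f = p" using p(4) by (simp only: mult.assoc)
    show "mfps_polynomial (q * h)" using p(2) assms(1) by (rule mfps_polynomial_mult)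
  qed (use p assms in simp_all)
qed

lemma mfps_rational_pderiv:
  assumes "mfps_rational f"
  shows "mfps_rational (mfps_pderiv i f)"
proof -
  obtain p q where p: "mfps_polynomial p" "mfps_polynomial q" "q \<noteq> 0" "q * f = p"
    using assms by (rule mfps_rationalE)
  have "q * mfps_pderiv i f = mfps_pderiv i p - mfps_pderiv i q * f"
    unfolding p(4)[symmetric] mfps_pderiv_mult by simp
  moreover have "mfps_rational (mfps_pderiv i p)"
    by (intro mfps_polynomial_imp_rational mfps_polynomial_pderiv p)
  moreover have "mfps_rational (mfps_pderiv i q * f)"
    by (intro mfps_rational_poly_mult mfps_polynomial_pderiv p assms)
  ultimately have "mfps_rational (q * mfps_pderiv i f)"
    using mfps_rational_diff by simp
  then show ?thesis by (rule mfps_rational_cancel[OF p(2,3)])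
qed

lemma mfps_rational_sum:
  "(\<And>j. j \<in> J \<Longrightarrow> mfps_rational (f j)) \<Longrightarrow> mfps_rational (\<Sum>j\<in>J. f j)"
  by (induction J rule: infinite_finite_induct)
    (auto intro: mfps_rational_add mfps_polynomial_imp_rational)

lemma Fract_mfps_rational:
  assumes "mfps_rational f"
  shows "Fract f 1 \<in> rational_functions"
proof -
  obtain p q where p: "mfps_polynomial p" "mfps_polynomial q" "q \<noteq> 0" "q * f = p"
    using assms unfolding mfps_rational_def by blast
  then have "Fract f 1 = Fract p q" by (auto simp: eq_fract algebra_simps)
  then show ?thesis using p unfolding rational_functions_def by blast
qed

lemma rational_functions_0: "0 \<in> rational_functions"
  using Fract_mfps_rational[OF mfps_polynomial_imp_rational[OF mfps_polynomial_0]]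
  by (simp add: Zero_fract_def)

lemma rational_functions_add:
  assumes "r \<in> rational_functions" "s \<in> rational_functions"
  shows "r + s \<in> rational_functions"
proof -
  obtain p q p' q' where r: "r = Fract p q" "mfps_polynomial p" "mfps_polynomial q" "q \<noteq> 0"
    and s: "s = Fract p' q'" "mfps_polynomial p'" "mfps_polynomial q'" "q' \<noteq> 0"
    using assms unfolding rational_functions_def by auto
  have "r + s = Fract (p * q' + p' * q) (q * q')" using r s by simp
  moreover have "mfps_polynomial (p * q' + p' * q)" "mfps_polynomial (q * q')" "q * q' \<noteq> 0"
    using r s by (simp_all add: mfps_polynomial_add mfps_polynomial_mult)
  ultimately show ?thesis unfolding rational_functions_def by blast
qed

lemma rational_functions_mult:
  assumes "r \<in> rational_functions" "s \<in> rational_functions"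
  shows "r * s \<in> rational_functions"
proof -
  obtain p q p' q' where r: "r = Fract p q" "mfps_polynomial p" "mfps_polynomial q" "q \<noteq> 0"
    and s: "s = Fract p' q'" "mfps_polynomial p'" "mfps_polynomial q'" "q' \<noteq> 0"
    using assms unfolding rational_functions_def by auto
  have "r * s = Fract (p * p') (q * q')" using r s by simp
  moreover have "mfps_polynomial (p * p')" "mfps_polynomial (q * q')" "q * q' \<noteq> 0"
    using r s by (simp_all add: mfps_polynomial_mult)
  ultimately show ?thesis unfolding rational_functions_def by blast
qed

lemma rational_functions_inverse:
  assumes "r \<in> rational_functions"
  shows "inverse r \<in> rational_functions"
proof -
  obtain p q where r: "r = Fract p q" "mfps_polynomial p" "mfps_polynomial q" "q \<noteq> 0"
    using assms unfolding rational_functions_def by auto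
  show ?thesis
  proof (cases "p = 0")
    case True
    then have "inverse r = 0" using r by (simp add: fract_collapse)
    then show ?thesis using rational_functions_0 by simp
  next
    case False
    then have "inverse r = Fract q p" using r by simp
    then show ?thesis using r False unfolding rational_functions_def by blast
  qed
qed

lemma rational_functions_sum:
  "(\<And>j. j \<in> J \<Longrightarrow> f j \<in> rational_functions) \<Longrightarrow> (\<Sum>j\<in>J. f j) \<in> rational_functions"
  by (induction J rule: infinite_finite_induct)
    (auto intro: rational_functions_add rational_functions_0)

lemma mfps_rational_derivs: "g \<in> mfps_derivs f \<Longrightarrow> mfps_rational f \<Longrightarrow> mfps_rational g"
  by (induction rule: mfps_derivs.induct) (auto intro: mfps_rational_pderiv)

text \<open>
  All derivatives of a rational series are rational, so over the rational functions they span a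
  space of dimension at most one: the field of rational functions itself, unless the series is zero.
\<close>

theorem mfps_rational_imp_holonomic:
  assumes f: "mfps_rational f"
  shows "holonomic f"
proof -
  let ?D = "(\<lambda>g. Fract g 1) ` mfps_derivs f"
  have D: "?D \<subseteq> rational_functions"
    using f mfps_rational_derivs Fract_mfps_rational by auto
  show ?thesis
  proof (cases "f = 0")
    case True
    have "g = 0" if "g \<in> mfps_derivs f" for g
      using that by induction (auto intro!: mfps_eqI simp: True mfps_pderiv_def)
    then have "?D \<subseteq> {Fract 0 1}" by auto
    then have "finite ?D" by (rule finite_subset) simp
    then show ?thesis unfolding holonomic_def by blast
  next
    case False
    have span: "rational_span E = rational_functions"
      if E: "E \<subseteq> rational_functions" "d \<in> E" "d \<noteq> 0" for E and d :: "(complex, 'a) mfps fract"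
    proof
      show "rational_span E \<subseteq> rational_functions"
        using E unfolding rational_span_def
        by (auto intro!: rational_functions_sum rational_functions_mult)
      show "rational_functions \<subseteq> rational_span E"
      proof
        fix r :: "(complex, 'a) mfps fract" assume "r \<in> rational_functions"
        then have "r * inverse d \<in> rational_functions"
          using E by (intro rational_functions_mult rational_functions_inverse) auto
        moreover have "r = (\<Sum>d'\<in>{d}. (r * inverse d) * d')" using E by simp
        ultimately show "r \<in> rational_span E"
          unfolding rational_span_def mem_Collect_eq using E
          by (intro exI[of _ "{d}"] exI[of _ "\<lambda>_. r * inverse d"]) blast
      qed
    qed
    have "Fract f 1 \<in> ?D" by (auto intro: mfps_derivs.base)
    moreover have "Fract f 1 \<noteq> 0" using False by (simp add: Zero_fract_def eq_fract)
    ultimately have "rational_span ?D = rational_functions" using D span by blast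
    moreover have "rational_span {1} = (rational_functions :: (complex, 'a) mfps fract set)"
    proof (rule span[of _ 1])
      show "{1} \<subseteq> (rational_functions :: (complex, 'a) mfps fract set)"
        using Fract_mfps_rational[OF mfps_polynomial_imp_rational[OF mfps_polynomial_1]]
        by (simp add: One_fract_def)
    qed simp_all
    ultimately show ?thesis unfolding holonomic_def by (metis finite.emptyI finite_insert)
  qed
qed

section \<open>Generating functions of weighted sets\<close>

text \<open>
  The coefficient at \<open>m\<close> counts the elements of weight \<open>m\<close>. It is meaningful only if all fibres of the
  weight function are finite, because an infinite set has cardinality zero.
\<close>

definition weight_gf :: "('x \<Rightarrow> nat^'n::finite) \<Rightarrow> 'x set \<Rightarrow> (complex, 'n) mfps" where
  "weight_gf \<omega> U = Mfps (\<lambda>m. of_nat (card {x\<in>U. \<omega> x = m}))"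

definition finite_fibres :: "('x \<Rightarrow> 'w) \<Rightarrow> 'x set \<Rightarrow> bool" where
  "finite_fibres \<omega> U \<longleftrightarrow> (\<forall>m. finite {x\<in>U. \<omega> x = m})"

lemma finite_fibresD: "finite_fibres \<omega> U \<Longrightarrow> finite {x\<in>U. \<omega> x = m}"
  by (simp add: finite_fibres_def)

lemma finite_fibres_subset:
  assumes "finite_fibres \<omega> U" "V \<subseteq> U"
  shows "finite_fibres \<omega> V"
  unfolding finite_fibres_def
proof
  fix m
  have "{x\<in>V. \<omega> x = m} \<subseteq> {x\<in>U. \<omega> x = m}" using assms(2) by blast
  then show "finite {x\<in>V. \<omega> x = m}" using finite_fibresD[OF assms(1)] by (rule finite_subset)
qed

lemma weight_gf_nth: "mfps_nth (weight_gf \<omega> U) m = of_nat (card {x\<in>U. \<omega> x = m})"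
  by (simp add: weight_gf_def)

lemma weight_gf_empty [simp]: "weight_gf \<omega> {} = 0"
  by (rule mfps_eqI) (simp add: weight_gf_nth)

lemma weight_gf_Un_Int:
  assumes "finite_fibres \<omega> U" "finite_fibres \<omega> V"
  shows "weight_gf \<omega> (U \<union> V) + weight_gf \<omega> (U \<inter> V) = weight_gf \<omega> U + weight_gf \<omega> V"
proof (rule mfps_eqI)
  fix m
  have "{x\<in>U \<union> V. \<omega> x = m} = {x\<in>U. \<omega> x = m} \<union> {x\<in>V. \<omega> x = m}"
    "{x\<in>U \<inter> V. \<omega> x = m} = {x\<in>U. \<omega> x = m} \<inter> {x\<in>V. \<omega> x = m}" by auto
  then have "card {x\<in>U \<union> V. \<omega> x = m} + card {x\<in>U \<inter> V. \<omega> x = m} =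
      card {x\<in>U. \<omega> x = m} + card {x\<in>V. \<omega> x = m}"
    by (simp only: card_Un_Int[OF finite_fibresD[OF assms(1)] finite_fibresD[OF assms(2)]])
  then show "mfps_nth (weight_gf \<omega> (U \<union> V) + weight_gf \<omega> (U \<inter> V)) m =
      mfps_nth (weight_gf \<omega> U + weight_gf \<omega> V) m"
    by (simp add: weight_gf_nth flip: of_nat_add)
qed

lemma weight_gf_Un_disjoint:
  assumes "finite_fibres \<omega> U" "finite_fibres \<omega> V" "U \<inter> V = {}"
  shows "weight_gf \<omega> (U \<union> V) = weight_gf \<omega> U + weight_gf \<omega> V"
  using weight_gf_Un_Int[OF assms(1,2)] assms(3) by simp

text \<open>
  An injective relabelling that raises all weights by \<open>a\<close> multiplies the series by a monomial. This is
  the source of all geometric series below.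
\<close>

lemma weight_gf_image:
  assumes "inj_on f U" "\<And>x. x \<in> U \<Longrightarrow> \<omega>' (f x) = \<omega> x + a"
  shows "weight_gf \<omega>' (f ` U) = mfps_monom a * weight_gf \<omega> U"
proof (rule mfps_eqI)
  fix m
  show "mfps_nth (weight_gf \<omega>' (f ` U)) m = mfps_nth (mfps_monom a * weight_gf \<omega> U) m"
  proof (cases "\<exists>k. m = k + a")
    case True
    then obtain k where m: "m = k + a" by blast
    have "{y\<in>f ` U. \<omega>' y = m} = f ` {x\<in>U. \<omega> x = k}"
      using assms(2) m by auto
    moreover have "inj_on f {x\<in>U. \<omega> x = k}" using assms(1) by (rule inj_on_subset) auto
    ultimately show ?thesis by (simp add: m weight_gf_nth mfps_nth_monom_mult_add card_image)
  next
    case False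
    then have "{y\<in>f ` U. \<omega>' y = m} = {}" using assms(2) by auto
    then have "mfps_nth (weight_gf \<omega>' (f ` U)) m = 0" by (simp only: weight_gf_nth) simp
    then show ?thesis using False mfps_nth_monom_mult_eq_0[of m a "weight_gf \<omega> U"] by simp
  qed
qed

lemma weight_gf_finite:
  assumes "finite U"
  shows "mfps_rational (weight_gf \<omega> U)"
proof (rule mfps_polynomial_imp_rational)
  have "{m. mfps_nth (weight_gf \<omega> U) m \<noteq> 0} \<subseteq> \<omega> ` U"
    by (auto simp: weight_gf_nth card_eq_0_iff)
  then show "mfps_polynomial (weight_gf \<omega> U)"
    unfolding mfps_polynomial_def using assms by (meson finite_imageI finite_subset)
qed

lemma one_minus_monom:
  fixes a :: "nat^'n::finite"
  assumes "a \<noteq> 0"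
  shows "mfps_polynomial (1 - mfps_monom a :: ('a::comm_ring_1, 'n) mfps)"
    and "(1 - mfps_monom a :: ('a, 'n) mfps) \<noteq> 0"
proof -
  show "mfps_polynomial (1 - mfps_monom a :: ('a, 'n) mfps)"
    by (rule mfps_polynomial_diff) simp_all
  have "mfps_nth (1 - mfps_monom a :: ('a, 'n) mfps) 0 = 1"
    using assms by (simp add: mfps_nth_one mfps_monom_def)
  then show "(1 - mfps_monom a :: ('a, 'n) mfps) \<noteq> 0" by auto
qed

lemma weight_gf_UN_disjoint:
  assumes "finite I" "finite_fibres \<omega> (\<Union>i\<in>I. U i)" "disjoint_family_on U I"
  shows "weight_gf \<omega> (\<Union>i\<in>I. U i) = (\<Sum>i\<in>I. weight_gf \<omega> (U i))"
  using assms
proof (induction I rule: finite_induct)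
  case (insert j I)
  have fin: "finite_fibres \<omega> (U j)" "finite_fibres \<omega> (\<Union>i\<in>I. U i)"
    using insert.prems(1) by (auto intro: finite_fibres_subset)
  have IH: "weight_gf \<omega> (\<Union>i\<in>I. U i) = (\<Sum>i\<in>I. weight_gf \<omega> (U i))"
    using insert.IH[OF fin(2)] insert.prems(2) by (auto simp: disjoint_family_on_def)
  have "U j \<inter> (\<Union>i\<in>I. U i) = {}"
    using insert.prems(2) insert.hyps by (fastforce simp: disjoint_family_on_def)
  then have "weight_gf \<omega> (U j \<union> (\<Union>i\<in>I. U i)) = weight_gf \<omega> (U j) + weight_gf \<omega> (\<Union>i\<in>I. U i)"
    by (rule weight_gf_Un_disjoint[OF fin])
  then show ?case using insert.hyps IH by simp
qed simp

text \<open>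
  Inclusion-exclusion: the intersections of the sets determine the series of their union.
\<close>

lemma weight_gf_Union_rational:
  assumes "finite I" "finite_fibres \<omega> (\<Union>i\<in>I. U i)"
    and "\<And>L. L \<subseteq> I \<Longrightarrow> L \<noteq> {} \<Longrightarrow> mfps_rational (weight_gf \<omega> (\<Inter>i\<in>L. U i))"
  shows "mfps_rational (weight_gf \<omega> (\<Union>i\<in>I. U i))"
  using assms
proof (induction I arbitrary: U rule: finite_induct)
  case empty
  then show ?case by (simp add: mfps_polynomial_imp_rational)
next
  case (insert j I)
  let ?R = "\<Union>i\<in>I. U i"
  have fin: "finite_fibres \<omega> (U j)" "finite_fibres \<omega> ?R"
    using insert.prems(1) by (auto intro: finite_fibres_subset)
  have "mfps_rational (weight_gf \<omega> (U j))" using insert.prems(2)[of "{j}"] by simp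
  moreover have "mfps_rational (weight_gf \<omega> ?R)"
    by (rule insert.IH[OF fin(2)]) (use insert.prems(2) in blast)
  moreover have "mfps_rational (weight_gf \<omega> (\<Union>i\<in>I. U j \<inter> U i))"
  proof (rule insert.IH)
    show "finite_fibres \<omega> (\<Union>i\<in>I. U j \<inter> U i)"
      using fin(1) by (rule finite_fibres_subset) auto
    show "mfps_rational (weight_gf \<omega> (\<Inter>i\<in>L. U j \<inter> U i))" if "L \<subseteq> I" "L \<noteq> {}" for L
    proof -
      have "(\<Inter>i\<in>L. U j \<inter> U i) = (\<Inter>i\<in>insert j L. U i)" using that(2) by auto
      then show ?thesis using insert.prems(2)[of "insert j L"] that by auto
    qed
  qed
  ultimately have "mfps_rational (weight_gf \<omega> (U j) + weight_gf \<omega> ?R - weight_gf \<omega> (\<Union>i\<in>I. U j \<inter> U i))"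
    by (intro mfps_rational_add mfps_rational_diff)
  also have "weight_gf \<omega> (U j) + weight_gf \<omega> ?R - weight_gf \<omega> (\<Union>i\<in>I. U j \<inter> U i) =
      weight_gf \<omega> (\<Union>i\<in>insert j I. U i)"
    using weight_gf_Un_Int[OF fin] by (simp only: UN_insert Int_UN_distrib diff_eq_eq)
  finally show ?case .
qed

section \<open>Dickson's lemma and down-closed sets of multisets\<close>

text \<open>
  Multisets over a finite set \<open>B\<close> play the role of the exponent vectors in \<open>\<nat>\<^sup>B\<close>; the order is \<open>\<subseteq>#\<close>.
\<close>

lemma replicate_mset_split:
  "k \<le> l \<Longrightarrow> replicate_mset l b = replicate_mset k b + replicate_mset (l - k) b"
  by (rule multiset_eqI) simp

lemma filter_mset_plus_replicate:
  "filter_mset (\<lambda>x. x \<noteq> b) u + replicate_mset (count u b) b = u"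
  by (rule multiset_eqI) simp

text \<open>
  Induction on the set of coordinates. The slices of \<open>C\<close> at the heights of a new coordinate \<open>b\<close> live over
  \<open>B\<close>. Finitely many elements generate the union of all slices, and they already occur at heights up
  to some \<open>K\<close>; so the generators of the slices of height at most \<open>K\<close> suffice.
\<close>

lemma dickson:
  assumes "finite B" "C \<subseteq> {u. set_mset u \<subseteq> B}"
  shows "\<exists>F. finite F \<and> F \<subseteq> C \<and> (\<forall>u\<in>C. \<exists>f\<in>F. f \<subseteq># u)"
  using assms
proof (induction B arbitrary: C rule: finite_induct)
  case empty
  then have "C \<subseteq> {{#}}" by auto
  then show ?case by (intro exI[of _ C]) (auto intro: finite_subset)
next
  case (insert b B)
  define S where "S k = {u. set_mset u \<subseteq> B \<and> u + replicate_mset k b \<in> C}" for k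
  have S_sub: "(\<Union>k. S k) \<subseteq> {u. set_mset u \<subseteq> B}" by (auto simp: S_def)
  have slice: "\<exists>G. finite G \<and> G \<subseteq> S k \<and> (\<forall>u\<in>S k. \<exists>g\<in>G. g \<subseteq># u)" for k
    by (rule insert.IH) (auto simp: S_def)
  obtain F where F: "finite F" "F \<subseteq> (\<Union>k. S k)" "\<forall>u\<in>(\<Union>k. S k). \<exists>f\<in>F. f \<subseteq># u"
    using insert.IH[of "\<Union>k. S k"] S_sub by blast
  obtain k where k: "\<And>f. f \<in> F \<Longrightarrow> f \<in> S (k f)" using F(2) by (metis UN_E subsetD)
  define K where "K = Max (insert 0 (k ` F))"
  have K: "k f \<le> K" if "f \<in> F" for f using F(1) that by (simp add: K_def)
  obtain G where G: "\<And>k. finite (G k)" "\<And>k. G k \<subseteq> S k"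
    "\<And>k u. u \<in> S k \<Longrightarrow> \<exists>g\<in>G k. g \<subseteq># u"
    using slice by metis
  define H where "H = (\<Union>k\<le>K. (\<lambda>g. g + replicate_mset k b) ` G k)"
  have "\<exists>h\<in>H. h \<subseteq># u" if u: "u \<in> C" for u
  proof -
    define v j where "v = filter_mset (\<lambda>x. x \<noteq> b) u" and "j = count u b"
    have uv: "u = v + replicate_mset j b"
      unfolding v_def j_def by (simp only: filter_mset_plus_replicate)
    have "set_mset v \<subseteq> B" using u insert.prems by (auto simp: v_def)
    then have v: "v \<in> S j" using u by (simp add: S_def uv)
    show ?thesis
    proof (cases "j \<le> K")
      case True
      obtain g where g: "g \<in> G j" "g \<subseteq># v" using G(3)[OF v] by blast
      then have "g + replicate_mset j b \<in> H" using True by (auto simp: H_def)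
      moreover have "g + replicate_mset j b \<subseteq># u" using g(2) unfolding uv by simp
      ultimately show ?thesis by blast
    next
      case False
      obtain f where f: "f \<in> F" "f \<subseteq># v" using F(3) v by blast
      obtain g where g: "g \<in> G (k f)" "g \<subseteq># f" using G(3)[OF k[OF f(1)]] by blast
      have "replicate_mset (k f) b \<subseteq># replicate_mset j b"
        using K[OF f(1)] False by (auto simp: subseteq_mset_def)
      then have "g + replicate_mset (k f) b \<subseteq># v + replicate_mset j b"
        using f g by (meson subset_mset.add_mono subset_mset.order_trans)
      moreover have "g + replicate_mset (k f) b \<in> H" using g(1) K[OF f(1)] by (auto simp: H_def)
      ultimately show ?thesis unfolding uv by blast
    qed
  qed
  moreover have "finite H" using G(1) by (auto simp: H_def)
  moreover have "H \<subseteq> C" using G(2) by (force simp: H_def S_def)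
  ultimately show ?case by blast
qed

text \<open>
  This is the rationality of the Hilbert series of a monomial ideal, stated for the set \<open>J\<close> of monomials
  outside the ideal. The slices of \<open>J\<close> at the heights of one coordinate \<open>b\<close> decrease and, by Dickson's lemma
  for their complements, are constant from some height on. The part of \<open>J\<close> from there on is a translate
  of a product with all multiples of \<open>b\<close> and contributes a geometric series; the finitely many
  remaining slices are handled by induction. Finiteness of the fibres excludes a direction of weight
  zero in the infinite part.
\<close>

lemma down_closed_rational:
  fixes w :: "'b \<Rightarrow> nat^'n::finite"
  assumes "finite B" "J \<subseteq> {u. set_mset u \<subseteq> B}" "\<And>u v. u + v \<in> J \<Longrightarrow> u \<in> J"
    and "finite_fibres (\<lambda>u. \<Sum>i\<in>#u. w i) J"
  shows "mfps_rational (weight_gf (\<lambda>u. \<Sum>i\<in>#u. w i) J)"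
  using assms
proof (induction B arbitrary: J rule: finite_induct)
  case empty
  then have "J \<subseteq> {{#}}" by auto
  then show ?case by (intro weight_gf_finite) (auto intro: finite_subset)
next
  case (insert b B)
  let ?\<omega> = "\<lambda>u. \<Sum>i\<in>#u. w i"
  note down = insert.prems(2) and fin = insert.prems(3)
  define S where "S k = {u. set_mset u \<subseteq> B \<and> u + replicate_mset k b \<in> J}" for k
  have slice: "filter_mset (\<lambda>x. x \<noteq> b) u \<in> S (count u b)" if "u \<in> J" for u
    using that insert.prems(1) by (auto simp: S_def filter_mset_plus_replicate)
  have S_anti: "S l \<subseteq> S k" if "k \<le> l" for k l
  proof
    fix u assume "u \<in> S l"
    then have "set_mset u \<subseteq> B" "(u + replicate_mset k b) + replicate_mset (l - k) b \<in> J"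
      by (simp_all add: S_def replicate_mset_split[OF that] add.assoc)
    then show "u \<in> S k" using down by (simp add: S_def)
  qed
  have S_gf: "mfps_rational (weight_gf ?\<omega> (S k))" for k
  proof (rule insert.IH)
    show "S k \<subseteq> {u. set_mset u \<subseteq> B}" by (auto simp: S_def)
    show "u \<in> S k" if "u + v \<in> S k" for u v
      using that down[of "u + replicate_mset k b" v] by (simp add: S_def ac_simps)
    show "finite_fibres ?\<omega> (S k)"
      unfolding finite_fibres_def
    proof
      fix m
      have "(\<lambda>u. u + replicate_mset k b) ` {u\<in>S k. ?\<omega> u = m} \<subseteq>
          {u\<in>J. ?\<omega> u = m + (\<Sum>i\<in>#replicate_mset k b. w i)}"
        by (auto simp: S_def)
      then have "finite ((\<lambda>u. u + replicate_mset k b) ` {u\<in>S k. ?\<omega> u = m})"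
        by (rule finite_subset) (rule finite_fibresD[OF fin])
      then show "finite {u\<in>S k. ?\<omega> u = m}"
        by (rule finite_imageD) (auto simp: inj_on_def)
    qed
  qed
  \<comment> \<open>The part of height at least \<open>k\<close>: its series obeys a recursion downwards from \<open>K\<close> to \<open>0\<close>.\<close>
  define T where "T k = {u\<in>J. k \<le> count u b}" for k
  have T_eq: "T k = T (Suc k) \<union> (\<lambda>u. u + replicate_mset k b) ` S k" for k
  proof (intro equalityI subsetI)
    fix u assume u: "u \<in> T k"
    show "u \<in> T (Suc k) \<union> (\<lambda>u. u + replicate_mset k b) ` S k"
    proof (cases "count u b = k")
      case True
      have "filter_mset (\<lambda>x. x \<noteq> b) u + replicate_mset k b = u"
        using filter_mset_plus_replicate[of b u] True by simp
      moreover have "filter_mset (\<lambda>x. x \<noteq> b) u \<in> S k" using slice[of u] u True by (simp add: T_def)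
      ultimately show ?thesis by (metis UnI2 image_eqI)
    qed (use u in \<open>auto simp: T_def\<close>)
  qed (use insert.hyps in \<open>auto simp: T_def S_def\<close>)
  have T_disj: "T (Suc k) \<inter> (\<lambda>u. u + replicate_mset k b) ` S k = {}" for k
    using insert.hyps by (auto simp: T_def S_def not_in_iff[symmetric] count_eq_zero_iff)
  have T_fin: "finite_fibres ?\<omega> (T k)" for k
    using fin by (rule finite_fibres_subset) (auto simp: T_def)
  have T_gf: "weight_gf ?\<omega> (T k) =
      weight_gf ?\<omega> (T (Suc k)) + mfps_monom (\<Sum>i\<in>#replicate_mset k b. w i) * weight_gf ?\<omega> (S k)" for k
  proof -
    have sub: "(\<lambda>u. u + replicate_mset k b) ` S k \<subseteq> T k" using T_eq[of k] by blast
    have "weight_gf ?\<omega> (T k) = weight_gf ?\<omega> (T (Suc k)) + weight_gf ?\<omega> ((\<lambda>u. u + replicate_mset k b) ` S k)"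
      by (subst T_eq) (intro weight_gf_Un_disjoint T_fin T_disj finite_fibres_subset[OF T_fin sub])
    also have "weight_gf ?\<omega> ((\<lambda>u. u + replicate_mset k b) ` S k) =
        mfps_monom (\<Sum>i\<in>#replicate_mset k b. w i) * weight_gf ?\<omega> (S k)"
      by (rule weight_gf_image) (auto simp: inj_on_def)
    finally show ?thesis .
  qed
  \<comment> \<open>A generator of the growing complements of the slices is missing from all slices beyond some height.\<close>
  have "\<exists>K. \<forall>k\<ge>K. S k = S K"
  proof -
    have "(\<Union>k. {u. set_mset u \<subseteq> B} - S k) \<subseteq> {u. set_mset u \<subseteq> B}" by blast
    from dickson[OF insert.hyps(1) this]
    obtain F where F: "finite F" "F \<subseteq> (\<Union>k. {u. set_mset u \<subseteq> B} - S k)"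
      "\<forall>u\<in>(\<Union>k. {u. set_mset u \<subseteq> B} - S k). \<exists>f\<in>F. f \<subseteq># u"
      by (elim exE conjE)
    have "\<forall>f\<in>F. \<exists>k. f \<notin> S k" using F(2) by blast
    then obtain k where k: "\<And>f. f \<in> F \<Longrightarrow> f \<notin> S (k f)" by metis
    define K where "K = Max (insert 0 (k ` F))"
    have K: "k f \<le> K" if "f \<in> F" for f using F(1) that by (simp add: K_def)
    have "S K \<subseteq> S l" for l
    proof
      fix u assume u: "u \<in> S K"
      show "u \<in> S l"
      proof (rule ccontr)
        assume "u \<notin> S l"
        moreover have "set_mset u \<subseteq> B" using u by (simp add: S_def)
        ultimately have "u \<in> (\<Union>k. {u. set_mset u \<subseteq> B} - S k)" by blast
        then obtain f where f: "f \<in> F" "f \<subseteq># u" using F(3) by meson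
        have "f \<notin> S K" using k[OF f(1)] S_anti[OF K[OF f(1)]] by blast
        moreover have "f \<in> S K"
        proof -
          have eq: "u + replicate_mset K b = (f + replicate_mset K b) + (u - f)"
            using subset_mset.add_diff_inverse[OF f(2)] by (metis add.assoc add.commute)
          have "u + replicate_mset K b \<in> J" using u by (simp add: S_def)
          then have "f + replicate_mset K b \<in> J" unfolding eq by (rule down)
          moreover have "set_mset f \<subseteq> B" using f(2) u set_mset_mono by (fastforce simp: S_def)
          ultimately show ?thesis by (simp add: S_def)
        qed
        ultimately show False by blast
      qed
    qed
    then show ?thesis using S_anti by blast
  qed
  then obtain K where K: "\<And>k. k \<ge> K \<Longrightarrow> S k = S K" by blast
  have "mfps_rational (weight_gf ?\<omega> (T K))"
  proof (cases "S K = {}")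
    case True
    have "T K = {}"
    proof (rule equals0I)
      fix u assume u: "u \<in> T K"
      then have "filter_mset (\<lambda>x. x \<noteq> b) u \<in> S (count u b)" using slice by (simp add: T_def)
      then show False using K[of "count u b"] u True by (simp add: T_def)
    qed
    then show ?thesis by (simp add: mfps_polynomial_imp_rational)
  next
    case False
    then obtain u where u: "u \<in> S K" by blast
    have wb: "w b \<noteq> 0"
    proof
      assume "w b = 0"
      then have zero: "?\<omega> (replicate_mset k b) = 0" for k by (induction k) auto
      have "replicate_mset k b \<in> J" for k
      proof -
        have "u \<in> S (max k K)" using K[of "max k K"] u by simp
        then have "replicate_mset (max k K) b + u \<in> J" by (simp add: S_def add.commute)
        then have "replicate_mset (max k K) b \<in> J" by (rule down)
        moreover have "replicate_mset (max k K) b = replicate_mset k b + replicate_mset (max k K - k) b"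
          by (rule replicate_mset_split) simp
        ultimately show ?thesis using down by simp
      qed
      then have "range (\<lambda>k. replicate_mset k b) \<subseteq> {u\<in>J. ?\<omega> u = 0}" using zero by auto
      then have "finite (range (\<lambda>k. replicate_mset k b))"
        using finite_fibresD[OF fin] by (rule finite_subset)
      moreover have "inj (\<lambda>k. replicate_mset k b)" by (rule injI) (metis size_replicate_mset)
      ultimately show False using finite_imageD infinite_UNIV_nat by blast
    qed
    \<comment> \<open>All slices from \<open>K\<close> on agree, so raising the height by one is a bijection.\<close>
    have "T (Suc K) = add_mset b ` T K"
    proof (intro equalityI subsetI)
      fix v assume v: "v \<in> T (Suc K)"
      then have bv: "b \<in># v" by (auto simp: T_def count_greater_zero_iff[symmetric] simp del: count_greater_zero_iff)
      then have "v = add_mset b (v - {#b#})" by simp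
      moreover have "v - {#b#} \<in> T K"
        using v down[of "v - {#b#}" "{#b#}"] bv by (auto simp: T_def)
      ultimately show "v \<in> add_mset b ` T K" by blast
    next
      fix v assume "v \<in> add_mset b ` T K"
      then obtain x where x: "v = add_mset b x" "x \<in> J" "K \<le> count x b" by (auto simp: T_def)
      define y where "y = filter_mset (\<lambda>x. x \<noteq> b) x"
      have xy: "y + replicate_mset (count x b) b = x"
        unfolding y_def by (rule filter_mset_plus_replicate)
      have "y \<in> S (count x b)" using slice x(2) by (simp add: y_def)
      then have "y \<in> S (Suc (count x b))" using K x(3) by (metis le_Suc_eq)
      then have "add_mset b (y + replicate_mset (count x b) b) \<in> J" by (simp add: S_def)
      then have "add_mset b x \<in> J" by (simp only: xy)
      then show "v \<in> T (Suc K)" using x by (simp add: T_def)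
    qed
    then have "weight_gf ?\<omega> (T (Suc K)) = mfps_monom (w b) * weight_gf ?\<omega> (T K)"
      by (simp only:) (rule weight_gf_image, auto simp: inj_on_def add.commute)
    moreover have "(1 - z) * f = h" if "f = g + h" "g = z * f" for f g h z :: "(complex, 'n) mfps"
    proof -
      have "(1 - z) * f = f - g" unfolding that(2) left_diff_distrib by simp
      also have "\<dots> = h" unfolding that(1) by simp
      finally show ?thesis .
    qed
    ultimately have "(1 - mfps_monom (w b)) * weight_gf ?\<omega> (T K) =
        mfps_monom (\<Sum>i\<in>#replicate_mset K b. w i) * weight_gf ?\<omega> (S K)"
      using T_gf[of K] by blast
    moreover have "mfps_rational (mfps_monom (\<Sum>i\<in>#replicate_mset K b. w i) * weight_gf ?\<omega> (S K))"
      by (intro mfps_rational_poly_mult S_gf) simp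
    ultimately show ?thesis
      using mfps_rational_cancel[OF one_minus_monom[OF wb]] by metis
  qed
  moreover have "mfps_rational (weight_gf ?\<omega> (T k))" if "mfps_rational (weight_gf ?\<omega> (T (Suc k)))" for k
    unfolding T_gf[of k] by (intro mfps_rational_add mfps_rational_poly_mult S_gf that) simp
  ultimately have "mfps_rational (weight_gf ?\<omega> (T 0))"
    by (rule inc_induct[OF le0])
  then show ?case by (simp add: T_def)
qed

section \<open>Translation-closed sets and graded translations\<close>

text \<open>
  The solution sets in \<open>\<nat>\<^sup>K\<close> of equations between affine maps to an abelian group have this form: the
  difference \<open>d\<close> of two solutions solves the homogeneous equations, so it may be added to every
  solution.
\<close>

definition translation_closed :: "'k multiset set \<Rightarrow> bool" where
  "translation_closed C \<longleftrightarrow> (\<forall>x\<in>C. \<forall>y\<in>C. \<forall>d. x + d \<in> C \<longrightarrow> y + d \<in> C)"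

lemma translation_closedD:
  "translation_closed C \<Longrightarrow> x \<in> C \<Longrightarrow> x + d \<in> C \<Longrightarrow> y \<in> C \<Longrightarrow> y + d \<in> C"
  unfolding translation_closed_def by blast

text \<open>
  The differences of elements of \<open>C\<close> that are multisets form a monoid \<open>M\<close> which acts on \<open>C\<close> and is closed
  under subtraction. Hence every element of \<open>C\<close> is a minimal element plus an element of \<open>M\<close>, every
  element of \<open>M\<close> is a sum of minimal nonzero elements of \<open>M\<close>, and both sets of minimal elements are finite
  by Dickson's lemma.
\<close>

lemma translation_closed_decomposition:
  assumes "finite K" "C \<subseteq> {u. set_mset u \<subseteq> K}" and C: "translation_closed C"
  obtains F B where "finite F" "F \<subseteq> C" "finite B" "\<And>b y. b \<in> B \<Longrightarrow> y \<in> C \<Longrightarrow> y + b \<in> C"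
    "\<And>u. u \<in> C \<Longrightarrow> \<exists>f\<in>F. \<exists>v. set_mset v \<subseteq> B \<and> u = f + \<Sum>\<^sub># v"
proof -
  define M where "M = {d. \<exists>x\<in>C. x + d \<in> C}"
  have M: "y + d \<in> C" if d: "d \<in> M" and y: "y \<in> C" for d y
  proof -
    obtain x where "x \<in> C" "x + d \<in> C" using d by (auto simp: M_def)
    then show ?thesis by (rule translation_closedD[OF C _ _ y])
  qed
  have MK: "set_mset d \<subseteq> K" if "d \<in> M" for d
  proof -
    have "\<exists>x. set_mset (x + d) \<subseteq> K" using that assms(2) unfolding M_def by blast
    then show ?thesis by auto
  qed
  from dickson[OF assms(1,2)]
  obtain F where F: "finite F" "F \<subseteq> C" "\<forall>u\<in>C. \<exists>f\<in>F. f \<subseteq># u"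
    by (elim exE conjE)
  have "M - {{#}} \<subseteq> {u. set_mset u \<subseteq> K}" using MK by blast
  from dickson[OF assms(1) this]
  obtain B where B: "finite B" "B \<subseteq> M - {{#}}" "\<forall>u\<in>M - {{#}}. \<exists>b\<in>B. b \<subseteq># u"
    by (elim exE conjE)
  have gen: "\<exists>v. set_mset v \<subseteq> B \<and> d = \<Sum>\<^sub># v" if "d \<in> M" for d
    using that
  proof (induction d rule: measure_induct_rule[of size])
    case (less d)
    show ?case
    proof (cases "d = {#}")
      case True
      then show ?thesis by (intro exI[of _ "{#}"]) simp
    next
      case False
      then have "d \<in> M - {{#}}" using less.prems by simp
      then obtain b where b: "b \<in> B" "b \<subseteq># d" using B(3) by meson
      then have bM: "b \<in> M" "b \<noteq> {#}" using B(2) by auto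
      obtain x where x: "x \<in> C" "x + d \<in> C" using less.prems by (auto simp: M_def)
      have d: "b + (d - b) = d" using b(2) by (rule subset_mset.add_diff_inverse)
      have "(x + b) + (d - b) \<in> C" using x(2) unfolding add.assoc d .
      moreover have "x + b \<in> C" using M bM x by blast
      ultimately have "d - b \<in> M" unfolding M_def by blast
      moreover have "size (d - b) < size d"
      proof -
        have "size d = size b + size (d - b)" using d by (metis size_union)
        then show ?thesis using bM(2) by (simp add: nonempty_has_size)
      qed
      ultimately obtain v where "set_mset v \<subseteq> B" "d - b = \<Sum>\<^sub># v" using less.IH by blast
      then show ?thesis using b(1) d by (intro exI[of _ "add_mset b v"]) auto
    qed
  qed
  show thesis
  proof (rule that)
    show "y + b \<in> C" if "b \<in> B" "y \<in> C" for b y using that M B(2) by blast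
    show "\<exists>f\<in>F. \<exists>v. set_mset v \<subseteq> B \<and> u = f + \<Sum>\<^sub># v" if u: "u \<in> C" for u
    proof -
      obtain f where f: "f \<in> F" "f \<subseteq># u" using F(3) u by meson
      have eq: "f + (u - f) = u" using f(2) by (rule subset_mset.add_diff_inverse)
      then have "f \<in> C \<and> f + (u - f) \<in> C" using u f(1) F(2) by auto
      then have "u - f \<in> M" unfolding M_def by blast
      then show ?thesis using gen f(1) eq by metis
    qed
  qed (use F B in auto)
qed

text \<open>
  The abstract properties of the translations of \<open>G\<^sup>n \<times> \<nat>\<^sup>n\<close> by elements of an abelian subgroup and by
  vectors: a translation is determined by its value at one point, and it changes the weight by a
  constant. They suffice for the counting argument.
\<close>

locale graded_translations =
  fixes X :: "'x set" and T :: "('x \<Rightarrow> 'x) set" and \<omega> :: "'x \<Rightarrow> nat^'n::finite"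
  assumes agree: "\<sigma> \<in> T \<Longrightarrow> \<tau> \<in> T \<Longrightarrow> x \<in> X \<Longrightarrow> y \<in> X \<Longrightarrow> \<sigma> x = \<tau> x \<Longrightarrow> \<sigma> y = \<tau> y"
    and shift: "\<tau> \<in> T \<Longrightarrow> \<exists>k. \<forall>x\<in>X. \<omega> (\<tau> x) = \<omega> x + k"
begin

text \<open>
  A piece is an affine parametrisation of the set \<open>h ` C\<close>: adding \<open>d\<close> to the parameter translates the
  point by an amount depending on \<open>d\<close> only. It need not be injective.
\<close>

definition piece :: "'k multiset set \<Rightarrow> ('k multiset \<Rightarrow> 'x) \<Rightarrow> bool" where
  "piece C h \<longleftrightarrow> (\<exists>K. finite K \<and> C \<subseteq> {u. set_mset u \<subseteq> K}) \<and> translation_closed C \<and> h ` C \<subseteq> X \<and>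
     (\<forall>x\<in>C. \<forall>d. x + d \<in> C \<longrightarrow> (\<exists>\<tau>\<in>T. \<forall>y\<in>C. h (y + d) = \<tau> (h y)))"

lemma pieceE:
  assumes "piece C h"
  obtains K where "finite K" "C \<subseteq> {u. set_mset u \<subseteq> K}" "translation_closed C" "h ` C \<subseteq> X"
  using assms unfolding piece_def by (elim exE conjE)

lemma piece_moves:
  assumes "piece C h" "x \<in> C" "x + d \<in> C"
  shows "\<exists>\<tau>\<in>T. \<forall>y\<in>C. h (y + d) = \<tau> (h y)"
proof -
  have "\<forall>x\<in>C. \<forall>d. x + d \<in> C \<longrightarrow> (\<exists>\<tau>\<in>T. \<forall>y\<in>C. h (y + d) = \<tau> (h y))"
    using assms(1) unfolding piece_def by (elim conjE)
  from this[rule_format, OF assms(2,3)] show ?thesis .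
qed

text \<open>
  The parametrisation is made injective by choosing the least parameter of each point. Write the
  elements of \<open>C\<close> as \<open>f j + (\<Sum>i\<in>#u. b i)\<close> with finitely many \<open>f j\<close> and \<open>b i\<close>, and order the pairs \<open>(j, u)\<close> by \<open>j\<close>
  first and then by the multiset order on \<open>u\<close>, which is a well-order compatible with addition. If
  \<open>(j, u)\<close> is beaten by \<open>(j', u')\<close> with the same image, then \<open>(j, u + v)\<close> is beaten by \<open>(j', u' + v)\<close>, which
  has the same image because both images are moved by the same translation. So for each \<open>j\<close> the
  parameters that win form a down-closed set, whose series is rational.
\<close>

lemma piece_rational:
  fixes C :: "'k multiset set"
  assumes P: "piece C h" and fin: "finite_fibres \<omega> (h ` C)"
  shows "mfps_rational (weight_gf \<omega> (h ` C))"
proof -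
  obtain K where K: "finite K" "C \<subseteq> {u. set_mset u \<subseteq> K}"
    and C: "translation_closed C" and hX: "h ` C \<subseteq> X"
    using P by (rule pieceE)
  obtain F B where F: "finite F" "F \<subseteq> C" and B: "finite B" "\<And>b y. b \<in> B \<Longrightarrow> y \<in> C \<Longrightarrow> y + b \<in> C"
    and FB: "\<And>u. u \<in> C \<Longrightarrow> \<exists>f\<in>F. \<exists>v. set_mset v \<subseteq> B \<and> u = f + \<Sum>\<^sub># v"
    by (rule translation_closed_decomposition[OF K C]) (rule that)
  obtain f where f: "bij_betw f {0..<card F} F" using ex_bij_betw_nat_finite[OF F(1)] by blast
  obtain b where b: "bij_betw b {0..<card B} B" using ex_bij_betw_nat_finite[OF B(1)] by blast
  define l r where "l = card F" and "r = card B"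
  have fC: "f j \<in> C" if "j < l" for j
    using bij_betwE[OF f] F(2) that by (auto simp: l_def)
  have bB: "y + b i \<in> C" if "i < r" "y \<in> C" for i y
    using bij_betwE[OF b] B(2) that by (auto simp: r_def)
  define N :: "nat multiset set" where "N = {u. set_mset u \<subseteq> {..<r}}"
  have N_add: "u + v \<in> N \<longleftrightarrow> u \<in> N \<and> v \<in> N" for u v by (auto simp: N_def)
  define p where "p j u = f j + (\<Sum>i\<in>#u. b i)" for j and u :: "nat multiset"
  define H where "H j u = h (p j u)" for j u
  have pC: "p j u \<in> C" if "j < l" "u \<in> N" for j u
    using that(2)
  proof (induction u)
    case empty
    then show ?case using fC[OF that(1)] by (simp add: p_def)
  next
    case (add i u)
    then have "p j u + b i \<in> C" by (intro bB) (auto simp: N_def)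
    then show ?case by (simp add: p_def ac_simps)
  qed
  have "\<exists>k. \<forall>y\<in>C. \<omega> (h (y + b i)) = \<omega> (h y) + k" if i: "i < r" for i
  proof (cases "C = {}")
    case False
    then obtain x where x: "x \<in> C" by blast
    obtain \<tau> where \<tau>: "\<tau> \<in> T" "\<forall>y\<in>C. h (y + b i) = \<tau> (h y)"
      using piece_moves[OF P x bB[OF i x]] by (elim bexE)
    obtain k where "\<forall>x\<in>X. \<omega> (\<tau> x) = \<omega> x + k" using shift[OF \<tau>(1)] by blast
    then show ?thesis using \<tau>(2) hX by (intro exI[of _ k]) auto
  qed simp
  then obtain w where w: "\<And>i y. i < r \<Longrightarrow> y \<in> C \<Longrightarrow> \<omega> (h (y + b i)) = \<omega> (h y) + w i" by metis
  have \<omega>H: "\<omega> (H j u) = (\<Sum>i\<in>#u. w i) + \<omega> (h (f j))" if "j < l" "u \<in> N" for j u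
    using that(2)
  proof (induction u)
    case empty
    then show ?case by (simp add: H_def p_def)
  next
    case (add i u)
    have "u \<in> N" "i < r" using add.prems by (auto simp: N_def)
    moreover have "p j (add_mset i u) = p j u + b i" by (simp add: p_def ac_simps)
    ultimately show ?case using w[of i "p j u"] pC[OF that(1)] add.IH by (simp add: H_def ac_simps)
  qed
  have persist: "H j (u + v) = H j' (u' + v)"
    if "j < l" "j' < l" "u \<in> N" "u' \<in> N" "v \<in> N" "H j u = H j' u'" for j j' u u' v
  proof -
    have eq: "p i (x + v) = p i x + (\<Sum>i\<in>#v. b i)" for i x by (simp add: p_def ac_simps)
    have "p j u \<in> C" "p j u + (\<Sum>i\<in>#v. b i) \<in> C" "p j' u' \<in> C"
      using pC[of j u] pC[of j "u + v"] pC[of j' u'] that by (auto simp: N_add eq)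
    then obtain \<tau> where "h (p j u + (\<Sum>i\<in>#v. b i)) = \<tau> (h (p j u))"
      "h (p j' u' + (\<Sum>i\<in>#v. b i)) = \<tau> (h (p j' u'))"
      using piece_moves[OF P, of "p j u" "\<Sum>i\<in>#v. b i"] by metis
    then show ?thesis using that(6) by (simp add: H_def eq)
  qed
  define J where "J j = {u\<in>N. \<forall>j'<l. \<forall>u'\<in>N. j' < j \<or> j' = j \<and> u' < u \<longrightarrow> H j' u' \<noteq> H j u}" for j
  have J_inj: "j = j' \<and> u = u'"
    if "j < l" "j' < l" "u \<in> J j" "u' \<in> J j'" "H j u = H j' u'" for j j' u u'
  proof -
    have "\<not> (i < i' \<or> i = i' \<and> v < v')" if "i < l" "v \<in> J i" "v' \<in> J i'" "H i v = H i' v'" for i i' v v'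
      using that unfolding J_def by blast
    from this[OF that(1,3,4,5)] this[OF that(2,4,3) that(5)[symmetric]]
    show ?thesis using linorder_less_linear[of j j'] linorder_less_linear[of u u'] by blast
  qed
  have cover: "h ` C = (\<Union>j<l. H j ` J j)"
  proof
    show "(\<Union>j<l. H j ` J j) \<subseteq> h ` C" using pC by (auto simp: H_def J_def)
    show "h ` C \<subseteq> (\<Union>j<l. H j ` J j)"
    proof
      fix x assume "x \<in> h ` C"
      then obtain u where u: "u \<in> C" "x = h u" by blast
      obtain c v where c: "c \<in> F" "set_mset v \<subseteq> B" "u = c + \<Sum>\<^sub># v" using FB[OF u(1)] by blast
      have "c \<in> f ` {0..<card F}" using f c(1) by (simp add: bij_betw_def)
      then obtain j where j: "j < l" "c = f j" by (auto simp: l_def)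
      define v' where "v' = image_mset (the_inv_into {0..<r} b) v"
      have b': "inj_on b {0..<r}" "b ` {0..<r} = B" using b by (simp_all add: bij_betw_def r_def)
      have inv: "the_inv_into {0..<r} b x \<in> {0..<r}" "b (the_inv_into {0..<r} b x) = x" if "x \<in># v" for x
        using the_inv_into_into[OF b'(1) _ subset_refl] f_the_inv_into_f[OF b'(1)] that c(2) b'(2) by blast+
      have "v' \<in> N" using inv(1) by (auto simp: v'_def N_def)
      moreover have "image_mset b v' = image_mset (\<lambda>x. x) v"
        unfolding v'_def multiset.map_comp by (rule image_mset_cong) (simp add: inv(2))
      ultimately have "v' \<in> N" "image_mset b v' = v" by simp_all
      then have ex: "\<exists>j. \<exists>v\<in>N. j < l \<and> H j v = x"
        using j c(3) u(2) by (intro exI[of _ j] bexI[of _ v']) (simp_all add: H_def p_def)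
      define j0 where "j0 = (LEAST j. \<exists>v\<in>N. j < l \<and> H j v = x)"
      have j0: "\<exists>v\<in>N. j0 < l \<and> H j0 v = x" unfolding j0_def using ex by (rule LeastI_ex)
      then have ex0: "\<exists>v. v \<in> N \<and> H j0 v = x" by blast
      define v0 where "v0 = (LEAST v. v \<in> N \<and> H j0 v = x)"
      have v0: "v0 \<in> N \<and> H j0 v0 = x" unfolding v0_def using ex0 by (rule LeastI_ex)
      have "v0 \<in> J j0"
        unfolding J_def
      proof (intro CollectI conjI allI ballI impI)
        fix j' u' assume *: "j' < l" "u' \<in> N" "j' < j0 \<or> j' = j0 \<and> u' < v0"
        show "H j' u' \<noteq> H j0 v0"
        proof
          assume "H j' u' = H j0 v0"
          then have x: "H j' u' = x" using v0 by simp
          then have "j0 \<le> j'" unfolding j0_def using * by (intro Least_le) blast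
          moreover have "v0 \<le> u'" if "j' = j0"
            unfolding v0_def using * x that by (intro Least_le) blast
          ultimately show False using *(3) by auto
        qed
      qed (use v0 in simp)
      then show "x \<in> (\<Union>j<l. H j ` J j)" using v0 j0 by blast
    qed
  qed
  have finH: "finite_fibres \<omega> (H j ` J j)" if "j < l" for j
    using fin by (rule finite_fibres_subset) (use cover that in blast)
  have "mfps_rational (weight_gf \<omega> (H j ` J j))" if j: "j < l" for j
  proof -
    have inj: "inj_on (H j) (J j)" using J_inj[OF j j] by (auto intro: inj_onI)
    have JN: "J j \<subseteq> N" by (auto simp: J_def)
    have "weight_gf \<omega> (H j ` J j) = mfps_monom (\<omega> (h (f j))) * weight_gf (\<lambda>u. \<Sum>i\<in>#u. w i) (J j)"
      using inj by (rule weight_gf_image) (use \<omega>H[OF j] JN in blast)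
    moreover have "mfps_rational (weight_gf (\<lambda>u. \<Sum>i\<in>#u. w i) (J j))"
    proof (rule down_closed_rational)
      show "J j \<subseteq> {u. set_mset u \<subseteq> {..<r}}" using JN by (simp add: N_def)
      show "u \<in> J j" if uv: "u + v \<in> J j" for u v
      proof -
        have uvN: "u \<in> N" "v \<in> N" using uv JN N_add by blast+
        have "H j' u' \<noteq> H j u" if "j' < l" "u' \<in> N" "j' < j \<or> j' = j \<and> u' < u" for j' u'
        proof
          assume "H j' u' = H j u"
          then have "H j' (u' + v) = H j (u + v)" using persist that(1,2) j uvN by blast
          moreover have "j' < j \<or> j' = j \<and> u' + v < u + v" using that(3) by auto
          moreover have "u' + v \<in> N" using that(2) uvN(2) N_add by blast
          ultimately show False using uv that(1) unfolding J_def by blast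
        qed
        then show ?thesis using uvN by (auto simp: J_def)
      qed
      show "finite_fibres (\<lambda>u. \<Sum>i\<in>#u. w i) (J j)"
        unfolding finite_fibres_def
      proof
        fix m
        have "H j ` {u\<in>J j. (\<Sum>i\<in>#u. w i) = m} \<subseteq> {x\<in>H j ` J j. \<omega> x = m + \<omega> (h (f j))}"
          using \<omega>H[OF j] JN by auto
        then have "finite (H j ` {u\<in>J j. (\<Sum>i\<in>#u. w i) = m})"
          using finite_fibresD[OF finH[OF j]] by (rule finite_subset)
        then show "finite {u\<in>J j. (\<Sum>i\<in>#u. w i) = m}"
          by (rule finite_imageD) (use inj in \<open>auto intro: inj_on_subset\<close>)
      qed
    qed simp
    ultimately show ?thesis by (simp add: mfps_rational_poly_mult)
  qed
  moreover have "disjoint_family_on (\<lambda>j. H j ` J j) {..<l}"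
    using J_inj by (auto simp: disjoint_family_on_def)
  ultimately have "mfps_rational (\<Sum>j<l. weight_gf \<omega> (H j ` J j))"
    and "weight_gf \<omega> (\<Union>j<l. H j ` J j) = (\<Sum>j<l. weight_gf \<omega> (H j ` J j))"
    using weight_gf_UN_disjoint[OF finite_lessThan fin[unfolded cover]]
    by (auto intro: mfps_rational_sum)
  then show ?thesis unfolding cover by (simp only:)
qed

end

text \<open>
  A multiset over \<open>I \<times> K\<close> encodes a family of multisets over \<open>K\<close> indexed by \<open>I\<close>. The encoding serves for the
  common parameters of several pieces and for the tuples of walks below.
\<close>

definition component :: "'i \<Rightarrow> ('i \<times> 'k) multiset \<Rightarrow> 'k multiset" where
  "component i u = image_mset snd (filter_mset (\<lambda>p. fst p = i) u)"

lemma component_add [simp]: "component i (u + v) = component i u + component i v"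
  by (simp add: component_def)

lemma set_component: "set_mset (component i u) = {k. (i, k) \<in># u}"
  by (force simp: component_def)

lemma component_surj:
  assumes "finite I"
  obtains u where "\<And>i. i \<in> I \<Longrightarrow> component i u = v i" "set_mset u \<subseteq> (SIGMA i:I. set_mset (v i))"
proof -
  have "\<exists>u. (\<forall>i\<in>I. component i u = v i) \<and> set_mset u \<subseteq> (SIGMA i:I. set_mset (v i))"
    using assms
  proof (induction I rule: finite_induct)
    case empty
    then show ?case by (intro exI[of _ "{#}"]) simp
  next
    case (insert j I)
    then obtain u where u: "\<forall>i\<in>I. component i u = v i" "set_mset u \<subseteq> (SIGMA i:I. set_mset (v i))"
      by blast
    have "set_mset (component j u) = {}" using u(2) insert.hyps by (auto simp: set_component)
    then have "component j u = {#}" by simp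
    moreover have "component j (image_mset (Pair j) (v j)) = v j"
      by (simp add: component_def filter_mset_image_mset multiset.map_comp o_def)
    moreover have "component i (image_mset (Pair j) (v j)) = {#}" if "i \<noteq> j" for i
      using that by (auto simp: component_def filter_mset_image_mset)
    ultimately have "component i (u + image_mset (Pair j) (v j)) = v i" if "i \<in> insert j I" for i
      using that u(1) by (cases "i = j") simp_all
    then show ?case using u(2)
      by (intro exI[of _ "u + image_mset (Pair j) (v j)"]) auto
  qed
  then show thesis using that by blast
qed

context graded_translations
begin

text \<open>
  The common points of several pieces are parametrised by the families of parameters with equal
  images. Such families are translation-closed: the translations of the single images agree at one
  point, hence everywhere.
\<close>

lemma piece_Inter:
  fixes C :: "'i \<Rightarrow> 'k multiset set"
  assumes I: "finite I" "i0 \<in> I" and P: "\<And>i. i \<in> I \<Longrightarrow> piece (C i) (h i)"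
  shows "\<exists>(D :: ('i \<times> 'k) multiset set) g. piece D g \<and> (\<Inter>i\<in>I. h i ` C i) = g ` D"
proof -
  have "\<exists>K. finite K \<and> C i \<subseteq> {u. set_mset u \<subseteq> K}" if "i \<in> I" for i
    using P[OF that] unfolding piece_def by (elim conjE)
  then obtain K where K: "\<And>i. i \<in> I \<Longrightarrow> finite (K i)" "\<And>i. i \<in> I \<Longrightarrow> C i \<subseteq> {u. set_mset u \<subseteq> K i}"
    by metis
  have tc: "translation_closed (C i)" if "i \<in> I" for i
    using P[OF that] unfolding piece_def by (elim conjE)
  have hX: "h i ` C i \<subseteq> X" if "i \<in> I" for i
    using P[OF that] unfolding piece_def by (elim conjE)
  define g where "g u = h i0 (component i0 u)" for u :: "('i \<times> 'k) multiset"
  define D where "D = {u. set_mset u \<subseteq> Sigma I K \<and> (\<forall>i\<in>I. component i u \<in> C i \<and> h i (component i u) = g u)}"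
  have D: "component i u \<in> C i" "h i (component i u) = g u" if "u \<in> D" "i \<in> I" for u i
    using that by (auto simp: D_def)
  have move: "\<exists>\<tau>\<in>T. \<forall>y\<in>D. \<forall>i\<in>I. h i (component i (y + d)) = \<tau> (g y)"
    if x: "x \<in> D" "x + d \<in> D" for x d
  proof -
    have "\<exists>\<tau>\<in>T. \<forall>y\<in>C i. h i (y + component i d) = \<tau> (h i y)" if i: "i \<in> I" for i
      using D(1)[OF x(2) i] unfolding component_add by (rule piece_moves[OF P[OF i] D(1)[OF x(1) i]])
    then obtain \<tau> where \<tau>: "\<And>i. i \<in> I \<Longrightarrow> \<tau> i \<in> T"
      "\<And>i y. i \<in> I \<Longrightarrow> y \<in> C i \<Longrightarrow> h i (y + component i d) = \<tau> i (h i y)" by metis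
    have gX: "g y \<in> X" if "y \<in> D" for y
      using D(1)[OF that I(2)] hX[OF I(2)] by (auto simp: g_def)
    have "h i (component i (y + d)) = \<tau> i0 (g y)" if "y \<in> D" "i \<in> I" for y i
    proof -
      have at: "h k (component k (z + d)) = \<tau> k (g z)" if "z \<in> D" "k \<in> I" for z k
        using \<tau>(2)[OF that(2) D(1)[OF that]] D(2)[OF that] by simp
      \<comment> \<open>Both sides are the common image of the parameter \<open>x + d\<close>.\<close>
      have "\<tau> i (g x) = \<tau> i0 (g x)"
        using at[OF x(1) that(2)] at[OF x(1) I(2)] D(2)[OF x(2) that(2)] D(2)[OF x(2) I(2)] by simp
      then have "\<tau> i (g y) = \<tau> i0 (g y)"
        using agree[OF \<tau>(1)[OF that(2)] \<tau>(1)[OF I(2)] gX[OF x(1)] gX[OF that(1)]] by simp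
      then show ?thesis using at[OF that] by simp
    qed
    then show ?thesis using \<tau>(1)[OF I(2)] by blast
  qed
  have "piece D g"
    unfolding piece_def
  proof (intro conjI ballI allI impI)
    show "\<exists>K. finite K \<and> D \<subseteq> {u. set_mset u \<subseteq> K}"
      using I(1) K(1) by (intro exI[of _ "Sigma I K"]) (auto simp: D_def)
    show "translation_closed D"
      unfolding translation_closed_def
    proof (intro ballI allI impI)
      fix x y d assume x: "x \<in> D" "x + d \<in> D" and y: "y \<in> D"
      obtain \<tau> where \<tau>: "\<And>i. i \<in> I \<Longrightarrow> h i (component i (y + d)) = \<tau> (g y)"
        using move[OF x] y by blast
      have "h i (component i (y + d)) = g (y + d)" if "i \<in> I" for i
        using \<tau>[OF that] \<tau>[OF I(2)] by (simp add: g_def)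
      moreover have "component i (y + d) \<in> C i" if "i \<in> I" for i
        using translation_closedD[OF tc[OF that] D(1)[OF x(1) that], of "component i d"]
          D(1)[OF x(2) that] D(1)[OF y that] by simp
      moreover have "set_mset (y + d) \<subseteq> Sigma I K" using x(2) y by (auto simp: D_def)
      ultimately show "y + d \<in> D" by (simp add: D_def)
    qed
    show "g ` D \<subseteq> X" using D(1)[OF _ I(2)] hX[OF I(2)] by (auto simp: g_def)
    show "\<exists>\<tau>\<in>T. \<forall>y\<in>D. g (y + d) = \<tau> (g y)" if "x \<in> D" "x + d \<in> D" for x d
      using move[OF that] I(2) unfolding g_def by blast
  qed
  moreover have "(\<Inter>i\<in>I. h i ` C i) = g ` D"
  proof
    show "g ` D \<subseteq> (\<Inter>i\<in>I. h i ` C i)" using D by (metis (no_types, lifting) INT_I image_eqI image_subsetI)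
    show "(\<Inter>i\<in>I. h i ` C i) \<subseteq> g ` D"
    proof
      fix x assume "x \<in> (\<Inter>i\<in>I. h i ` C i)"
      then have "\<forall>i\<in>I. \<exists>v\<in>C i. h i v = x" by blast
      then obtain v where v: "\<And>i. i \<in> I \<Longrightarrow> v i \<in> C i" "\<And>i. i \<in> I \<Longrightarrow> h i (v i) = x" by metis
      obtain u where u: "\<And>i. i \<in> I \<Longrightarrow> component i u = v i" "set_mset u \<subseteq> (SIGMA i:I. set_mset (v i))"
        using component_surj[OF I(1), of v] by blast
      have "set_mset u \<subseteq> Sigma I K" using u(2) v(1) K(2) by fastforce
      then have "u \<in> D" "g u = x" using u v I(2) by (auto simp: D_def g_def)
      then show "x \<in> g ` D" by blast
    qed
  qed
  ultimately show ?thesis by blast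
qed

theorem pieces_rational:
  fixes C :: "'i \<Rightarrow> 'k multiset set"
  assumes I: "finite I" and P: "\<And>i. i \<in> I \<Longrightarrow> piece (C i) (h i)"
    and fin: "finite_fibres \<omega> (\<Union>i\<in>I. h i ` C i)"
  shows "mfps_rational (weight_gf \<omega> (\<Union>i\<in>I. h i ` C i))"
  using I fin
proof (rule weight_gf_Union_rational)
  fix L assume L: "L \<subseteq> I" "L \<noteq> {}"
  then obtain i0 where i0: "i0 \<in> L" by blast
  obtain D :: "('i \<times> 'k) multiset set" and g where D: "piece D g" "(\<Inter>i\<in>L. h i ` C i) = g ` D"
    using piece_Inter[OF finite_subset[OF L(1) I] i0, of C h] P L(1) by blast
  have "finite_fibres \<omega> (g ` D)"
    using fin by (rule finite_fibres_subset) (use D(2) i0 L(1) in blast)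
  then show "mfps_rational (weight_gf \<omega> (\<Inter>i\<in>L. h i ` C i))"
    unfolding D(2) by (rule piece_rational[OF D(1)])
qed

end

section \<open>Walks in a finite directed graph\<close>

text \<open>
  \<open>walk src tgt p v q\<close>: some walk from \<open>p\<close> to \<open>q\<close> uses each edge as often as \<open>v\<close> does. The order of the edges
  is forgotten, since only sums over the edges of the walk matter.
\<close>

inductive walk :: "('e \<Rightarrow> 'v) \<Rightarrow> ('e \<Rightarrow> 'v) \<Rightarrow> 'v \<Rightarrow> 'e multiset \<Rightarrow> 'v \<Rightarrow> bool"
  for src tgt p where
  empty: "walk src tgt p {#} p"
| snoc: "walk src tgt p v (src e) \<Longrightarrow> walk src tgt p (add_mset e v) (tgt e)"

lemma walk_append:
  assumes "walk src tgt q v r" "walk src tgt p u q"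
  shows "walk src tgt p (u + v) r"
  using assms by (induction rule: walk.induct) (auto intro: walk.snoc)

lemma walk_balance:
  assumes "walk src tgt p v q"
  shows "size {#e \<in># v. src e = x#} + (if q = x then 1 else 0) =
    size {#e \<in># v. tgt e = x#} + (if p = x then 1 else 0)"
  using assms by (induction rule: walk.induct) (auto split: if_splits)

lemma walk_split_at:
  assumes "walk src tgt p y q" "e \<in># y"
  shows "\<exists>u v. y = u + v \<and> walk src tgt p u (src e) \<and> walk src tgt (src e) v q"
  using assms
proof (induction rule: walk.induct)
  case (snoc v f)
  show ?case
  proof (cases "e = f")
    case True
    have "add_mset f v = v + {#f#}" by simp
    moreover have "walk src tgt (src f) {#f#} (tgt f)" by (intro walk.snoc walk.empty)
    ultimately show ?thesis using snoc.hyps True by blast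
  next
    case False
    then obtain u w where uw: "v = u + w" "walk src tgt p u (src e)" "walk src tgt (src e) w (src f)"
      using snoc.IH snoc.prems by auto
    then have "add_mset f v = u + add_mset f w" "walk src tgt (src e) (add_mset f w) (tgt f)"
      by (auto intro: walk.snoc)
    then show ?thesis using uw(2) by blast
  qed
qed simp

definition balanced :: "('e \<Rightarrow> 'v) \<Rightarrow> ('e \<Rightarrow> 'v) \<Rightarrow> 'e multiset \<Rightarrow> bool" where
  "balanced src tgt d \<longleftrightarrow> (\<forall>x. size {#e \<in># d. src e = x#} = size {#e \<in># d. tgt e = x#})"

text \<open>
  Euler's argument: a longest trail from \<open>src e\<close> within \<open>d\<close> can only get stuck where it began.
\<close>

lemma balanced_closed_walk:
  assumes d: "balanced src tgt d" and e: "e \<in># d"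
  shows "\<exists>c. c \<subseteq># d \<and> c \<noteq> {#} \<and> walk src tgt (src e) c (src e)"
proof -
  define P where "P v \<longleftrightarrow> v \<subseteq># d \<and> (\<exists>q. walk src tgt (src e) v q)" for v
  have "walk src tgt (src e) {#e#} (tgt e)" by (intro walk.snoc walk.empty)
  then have Pe: "P {#e#}" using e by (auto simp: P_def)
  have "\<forall>v. P v \<longrightarrow> size v < Suc (size d)"
    by (simp add: P_def size_mset_mono less_Suc_eq_le)
  from ex_has_greatest_nat[OF Pe this]
  obtain v where v: "P v" "\<forall>u. P u \<longrightarrow> size u \<le> size v" by (elim exE conjE)
  then obtain q where q: "v \<subseteq># d" "walk src tgt (src e) v q" by (auto simp: P_def)
  have "q = src e"
  proof (rule ccontr)
    assume neq: "q \<noteq> src e"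
    have "size {#f \<in># v. src f = q#} < size {#f \<in># v. tgt f = q#}"
      using walk_balance[OF q(2), of q] neq by simp
    also have "\<dots> \<le> size {#f \<in># d. tgt f = q#}"
      by (intro size_mset_mono multiset_filter_mono q)
    also have "\<dots> = size {#f \<in># d. src f = q#}" using d by (simp add: balanced_def)
    finally have lt: "size {#f \<in># v. src f = q#} < size {#f \<in># d. src f = q#}" .
    have "d = v + (d - v)" using q(1) by simp
    then have "{#f \<in># d. src f = q#} = {#f \<in># v. src f = q#} + {#f \<in># d - v. src f = q#}"
      by (metis filter_union_mset)
    then have "{#f \<in># d - v. src f = q#} \<noteq> {#}" using lt by auto
    then obtain f where "f \<in># {#f \<in># d - v. src f = q#}" by (rule multiset_nonemptyE)
    then have f: "f \<in># d - v" "src f = q" by (simp_all only: set_mset_filter mem_Collect_eq)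
    have "v + {#f#} \<subseteq># v + (d - v)" using f(1) by (simp only: subset_mset.add_le_cancel_left mset_subset_eq_single)
    then have "add_mset f v \<subseteq># d" using q(1) by simp
    moreover have "walk src tgt (src e) (add_mset f v) (tgt f)"
      using q(2) f(2) by (auto intro: walk.snoc)
    ultimately have "P (add_mset f v)" by (auto simp: P_def)
    then have "size (add_mset f v) \<le> size v" using spec[OF v(2), of "add_mset f v"] by (rule rev_mp)
    then show False by simp
  qed
  moreover have "v \<noteq> {#}" using spec[OF v(2), of "{#e#}"] Pe by auto
  ultimately show ?thesis using q by blast
qed

text \<open>
  A balanced multiset of edges is a sum of closed walks, and each of them can be inserted where the
  walk \<open>y\<close> passes through its starting point.
\<close>

lemma walk_insert_balanced:
  assumes "balanced src tgt d" "set_mset d \<subseteq> set_mset y" "walk src tgt p y q"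
  shows "walk src tgt p (y + d) q"
  using assms
proof (induction d arbitrary: y rule: measure_induct_rule[of size])
  case (less d)
  show ?case
  proof (cases "d = {#}")
    case False
    then obtain e where e: "e \<in># d" by blast
    obtain c where c: "c \<subseteq># d" "c \<noteq> {#}" "walk src tgt (src e) c (src e)"
      using balanced_closed_walk[OF less.prems(1) e] by blast
    obtain u v where uv: "y = u + v" "walk src tgt p u (src e)" "walk src tgt (src e) v q"
      using walk_split_at[OF less.prems(3)] e less.prems(2) by blast
    have d: "c + (d - c) = d" using c(1) by (rule subset_mset.add_diff_inverse)
    have "walk src tgt p (u + (c + v)) q"
      by (intro walk_append[OF walk_append[OF uv(3) c(3)] uv(2)])
    then have walk: "walk src tgt p (y + c) q" by (simp add: uv(1) ac_simps)
    have "balanced src tgt (d - c)"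
      unfolding balanced_def
    proof
      fix x
      have "size {#e \<in># c. src e = x#} = size {#e \<in># c. tgt e = x#}"
        using walk_balance[OF c(3), of x] by simp
      moreover have "size {#e \<in># c + (d - c). src e = x#} = size {#e \<in># c + (d - c). tgt e = x#}"
        unfolding d using less.prems(1) by (simp add: balanced_def)
      ultimately show "size {#e \<in># d - c. src e = x#} = size {#e \<in># d - c. tgt e = x#}"
        by simp
    qed
    moreover have "size (d - c) < size d"
    proof -
      have "size d = size c + size (d - c)" using d by (metis size_union)
      then show ?thesis using c(2) by (simp add: nonempty_has_size)
    qed
    moreover have "set_mset (d - c) \<subseteq> set_mset (y + c)"
      using less.prems(2) by (auto dest: in_diffD)
    ultimately have "walk src tgt p (y + c + (d - c)) q" using less.IH walk by blast
    then show ?thesis unfolding add.assoc d .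
  qed (use less.prems in simp)
qed

text \<open>
  Fixing the set \<open>F\<close> of edges in use is what makes closed walks available for insertion: the
  difference of two such walks is balanced and lies within \<open>F\<close>.
\<close>

lemma walks_translation_closed:
  "translation_closed {v. walk src tgt p v q \<and> set_mset v = F}"
  unfolding translation_closed_def
proof (intro ballI allI impI)
  fix x y d
  assume x: "x \<in> {v. walk src tgt p v q \<and> set_mset v = F}" "x + d \<in> {v. walk src tgt p v q \<and> set_mset v = F}"
    and y: "y \<in> {v. walk src tgt p v q \<and> set_mset v = F}"
  have "balanced src tgt d"
    unfolding balanced_def
  proof
    fix z
    show "size {#e \<in># d. src e = z#} = size {#e \<in># d. tgt e = z#}"
      using walk_balance[of src tgt p x q z] walk_balance[of src tgt p "x + d" q z] x by simp
  qed
  then show "y + d \<in> {v. walk src tgt p v q \<and> set_mset v = F}"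
    using walk_insert_balanced[of src tgt d y p q] x y by auto
qed

section \<open>Replacing weights by upper bounds\<close>

text \<open>
  In the coordinates in \<open>I\<close> an element is recorded with every bound for its weight, in the others only
  with its weight. Upper bounds are easier to describe than least weights, and they lose nothing:
  each coordinate in \<open>I\<close> multiplies the series by \<open>1 / (1 - z\<^sub>i)\<close>.
\<close>

definition slack :: "('x \<Rightarrow> nat^'n::finite) \<Rightarrow> 'x set \<Rightarrow> 'n set \<Rightarrow> ('x \<times> (nat^'n)) set" where
  "slack wt U I = {(x, m). x \<in> U \<and> (\<forall>i. if i \<in> I then wt x $ i \<le> m $ i else wt x $ i = m $ i)}"

lemma finite_fibres_slack:
  fixes wt :: "'x \<Rightarrow> nat^'n::finite"
  assumes "finite_fibres wt U"
  shows "finite_fibres snd (slack wt U I)"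
  unfolding finite_fibres_def
proof
  fix m :: "nat^'n"
  have "{y\<in>slack wt U I. snd y = m} \<subseteq>
      (\<Union>p\<in>{p. \<forall>i. p $ i \<le> (\<Sum>i\<in>UNIV. m $ i)}. {x\<in>U. wt x = p}) \<times> {m}"
  proof
    fix y assume y: "y \<in> {y\<in>slack wt U I. snd y = m}"
    then have "wt (fst y) $ i \<le> m $ i" for i
      by (auto simp: slack_def split: if_splits dest: spec[of _ i])
    moreover have "m $ i \<le> (\<Sum>i\<in>UNIV. m $ i)" for i by (rule member_le_sum) auto
    ultimately have "wt (fst y) $ i \<le> (\<Sum>i\<in>UNIV. m $ i)" for i using order_trans by blast
    then show "y \<in> (\<Union>p\<in>{p. \<forall>i. p $ i \<le> (\<Sum>i\<in>UNIV. m $ i)}. {x\<in>U. wt x = p}) \<times> {m}"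
      using y by (auto simp: slack_def)
  qed
  moreover have "finite ((\<Union>p\<in>{p. \<forall>i. p $ i \<le> (\<Sum>i\<in>UNIV. m $ i)}. {x\<in>U. wt x = p}) \<times> {m})"
    using finite_fibresD[OF assms] by (intro finite_cartesian_product finite_UN_I finite_vec_le) auto
  ultimately show "finite {y\<in>slack wt U I. snd y = m}" by (rule finite_subset)
qed

text \<open>
  A bound in coordinate \<open>i\<close> is either exact or remains a bound after lowering it by one; this is the
  recursion \<open>?S = slack wt U I \<union> ?f ` ?S\<close>.
\<close>

lemma slack_rational_step:
  fixes wt :: "'x \<Rightarrow> nat^'n::finite"
  assumes fin: "finite_fibres wt U" and i: "i \<notin> I"
    and "mfps_rational (weight_gf snd (slack wt U (insert i I)))"
  shows "mfps_rational (weight_gf snd (slack wt U I))"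
proof -
  let ?e = "axis i (Suc 0) :: nat^'n"
  let ?S = "slack wt U (insert i I)" and ?f = "\<lambda>(x, m). (x, m + ?e)"
  have e: "?e $ j = (if j = i then 1 else 0)" for j by (simp add: axis_def)
  have eq: "?S = slack wt U I \<union> ?f ` ?S"
  proof
    show "slack wt U I \<union> ?f ` ?S \<subseteq> ?S"
    proof
      fix y assume "y \<in> slack wt U I \<union> ?f ` ?S"
      then show "y \<in> ?S"
      proof
        assume "y \<in> slack wt U I"
        then show ?thesis using i by (auto simp: slack_def split: if_splits dest: spec[of _ i])
      next
        assume "y \<in> ?f ` ?S"
        then obtain x m where y: "y = (x, m + ?e)" "(x, m) \<in> ?S" by auto
        have "if j \<in> insert i I then wt x $ j \<le> (m + ?e) $ j else wt x $ j = (m + ?e) $ j" for j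
        proof -
          have "if j \<in> insert i I then wt x $ j \<le> m $ j else wt x $ j = m $ j"
            using y(2) by (simp add: slack_def)
          then show ?thesis by (auto simp: e split: if_splits)
        qed
        moreover have "x \<in> U" using y(2) by (simp add: slack_def)
        ultimately show ?thesis unfolding slack_def y(1) by blast
      qed
    qed
    show "?S \<subseteq> slack wt U I \<union> ?f ` ?S"
    proof
      fix y assume y: "y \<in> ?S"
      obtain x m where xm: "y = (x, m)" by force
      have x: "x \<in> U" and le: "if j \<in> insert i I then wt x $ j \<le> m $ j else wt x $ j = m $ j" for j
        using y by (simp_all add: slack_def xm)
      show "y \<in> slack wt U I \<union> ?f ` ?S"
      proof (cases "wt x $ i = m $ i")
        case True
        have "if j \<in> I then wt x $ j \<le> m $ j else wt x $ j = m $ j" for j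
          using le[of j] True by (cases "j = i") auto
        then show ?thesis using x by (simp add: slack_def xm)
      next
        case False
        then have lt: "wt x $ i < m $ i" using le[of i] by simp
        have "m - ?e + ?e = m" using lt by (auto simp: vec_eq_iff e)
        moreover have "if j \<in> insert i I then wt x $ j \<le> (m - ?e) $ j else wt x $ j = (m - ?e) $ j" for j
          using le[of j] lt by (cases "j = i") (auto simp: e)
        then have "(x, m - ?e) \<in> ?S" using x unfolding slack_def by blast
        ultimately have "y \<in> ?f ` ?S" by (intro image_eqI[of _ _ "(x, m - ?e)"]) (simp_all add: xm)
        then show ?thesis by blast
      qed
    qed
  qed
  have "weight_gf snd ?S = weight_gf snd (slack wt U I) + weight_gf snd (?f ` ?S)"
  proof (subst eq, rule weight_gf_Un_disjoint)
    show "finite_fibres snd (?f ` ?S)"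
      using finite_fibres_slack[OF fin, of "insert i I"] by (rule finite_fibres_subset) (use eq in blast)
    show "slack wt U I \<inter> ?f ` ?S = {}"
    proof (rule equals0I)
      fix y assume y: "y \<in> slack wt U I \<inter> ?f ` ?S"
      then obtain x m where xm: "y = (x, m + ?e)" "(x, m) \<in> ?S" by auto
      have "wt x $ i \<le> m $ i" using xm(2) by (auto simp: slack_def dest: spec[of _ i])
      moreover have "wt x $ i = (m + ?e) $ i" using y xm(1) i by (auto simp: slack_def dest: spec[of _ i])
      ultimately show False by (simp add: e)
    qed
  qed (rule finite_fibres_slack[OF fin])
  moreover have "weight_gf snd (?f ` ?S) = mfps_monom ?e * weight_gf snd ?S"
    by (rule weight_gf_image) (auto simp: inj_on_def)
  ultimately have "weight_gf snd (slack wt U I) = weight_gf snd ?S - mfps_monom ?e * weight_gf snd ?S"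
    by (metis add_diff_cancel_right')
  then show ?thesis using assms(3) by (simp only:) (intro mfps_rational_diff mfps_rational_poly_mult mfps_polynomial_monom)
qed

lemma slack_rational:
  fixes wt :: "'x \<Rightarrow> nat^'n::finite"
  assumes fin: "finite_fibres wt U" and "mfps_rational (weight_gf snd (slack wt U UNIV))"
  shows "mfps_rational (weight_gf wt U)"
proof -
  have "mfps_rational (weight_gf snd (slack wt U I)) \<Longrightarrow> mfps_rational (weight_gf snd (slack wt U {}))" for I
    using finite[of I] by (induction I rule: finite_induct) (auto intro: slack_rational_step[OF fin])
  then have "mfps_rational (weight_gf snd (slack wt U {}))" using assms(2) .
  moreover have "slack wt U {} = (\<lambda>x. (x, wt x)) ` U"
    by (auto simp: slack_def vec_eq_iff)
  moreover have "weight_gf snd ((\<lambda>x. (x, wt x)) ` U) = mfps_monom 0 * weight_gf wt U"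
    by (rule weight_gf_image) (auto simp: inj_on_def)
  ultimately show ?thesis by (simp add: mfps_monom_0)
qed

section \<open>Equations over a group with an abelian subgroup of finite index\<close>

lemma presented_induct [consumes 1, case_names one letter mult]:
  assumes "x \<in> carrier (presented A R)" and one: "P \<one>\<^bsub>presented A R\<^esub>"
    and letter: "\<And>a. a \<in> A \<Longrightarrow> P (word_class A R [a])"
    and mult: "\<And>x y. x \<in> carrier (presented A R) \<Longrightarrow> y \<in> carrier (presented A R) \<Longrightarrow> P x \<Longrightarrow> P y \<Longrightarrow>
      P (x \<otimes>\<^bsub>presented A R\<^esub> y)"
  shows "P x"
proof -
  have "P (word_class A R w)" if "w \<in> lists A" for w
    using that
  proof (induction w rule: lists.induct)
    case Nil
    then show ?case using one by (simp add: presented_def)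
  next
    case (Cons a w)
    have "P (word_class A R [a] \<otimes>\<^bsub>presented A R\<^esub> word_class A R w)"
      using Cons letter by (intro mult) (auto simp: presented_def)
    then show ?case using Cons by (simp add: presented_mult)
  qed
  then show ?thesis using assms(1) by (auto simp: presented_def)
qed

lemma free_group_inverse_letter:
  "word_class UNIV free_group_rels [(i, False)] = inv\<^bsub>free_group\<^esub> (free_gen i)"
proof -
  interpret H: group free_group by (rule free_group_group)
  have "([(i, False), (i, True)], []) \<in> free_group_rels" by (auto simp: free_group_rels_def)
  from word_cong.rel[OF this, of UNIV "[]" "[]"]
  have "word_class UNIV free_group_rels [(i, False)] \<otimes>\<^bsub>free_group\<^esub> free_gen i = \<one>\<^bsub>free_group\<^esub>"
    by (simp add: free_gen_def free_group_def presented_mult word_class_eq_iff)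
       (simp add: presented_def word_class_eq_iff)
  then show ?thesis
    by (rule H.inv_equality[symmetric]) (auto simp: free_gen_def free_group_def presented_def)
qed

text \<open>
  A congruence with finitely many classes for which the elements congruent to the unit commute; these
  elements form an abelian normal subgroup of finite index. The congruence is given by a map \<open>cls\<close>
  whose fibres on the carrier are the classes.
\<close>

locale abelian_kernel_congruence = group G for G (structure) +
  fixes cls :: "'a \<Rightarrow> 'q"
  assumes finite_classes: "finite (cls ` carrier G)"
    and cls_mult: "x \<in> carrier G \<Longrightarrow> x' \<in> carrier G \<Longrightarrow> y \<in> carrier G \<Longrightarrow> y' \<in> carrier G \<Longrightarrow>
      cls x = cls x' \<Longrightarrow> cls y = cls y' \<Longrightarrow> cls (x \<otimes> y) = cls (x' \<otimes> y')"
    and unit_class_comm: "a \<in> carrier G \<Longrightarrow> b \<in> carrier G \<Longrightarrow> cls a = cls \<one> \<Longrightarrow> cls b = cls \<one> \<Longrightarrow>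
      a \<otimes> b = b \<otimes> a"
begin

definition unit_class :: "'a set" where
  "unit_class = {a \<in> carrier G. cls a = cls \<one>}"

lemma unit_class_carrier: "a \<in> unit_class \<Longrightarrow> a \<in> carrier G"
  by (simp add: unit_class_def)

lemma cancel_inv:
  "x \<in> carrier G \<Longrightarrow> y \<in> carrier G \<Longrightarrow> inv x \<otimes> (x \<otimes> y) = y"
  "x \<in> carrier G \<Longrightarrow> y \<in> carrier G \<Longrightarrow> x \<otimes> (inv x \<otimes> y) = y"
  by (simp_all add: m_assoc[symmetric])

lemma cls_unit_class_mult: "a \<in> unit_class \<Longrightarrow> x \<in> carrier G \<Longrightarrow> cls (a \<otimes> x) = cls x"
  using cls_mult[of a \<one> x x] by (simp add: unit_class_def)

lemma cls_inv:
  assumes "x \<in> carrier G" "y \<in> carrier G" "cls x = cls y"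
  shows "cls (inv x) = cls (inv y)"
proof -
  have "cls (inv x \<otimes> y) = cls (inv x \<otimes> x)" using assms by (intro cls_mult) auto
  then have "cls ((inv x \<otimes> y) \<otimes> inv y) = cls ((inv x \<otimes> x) \<otimes> inv y)"
    using assms by (intro cls_mult) auto
  then show ?thesis using assms by (simp add: m_assoc)
qed

lemma div_in_unit_class:
  assumes "x \<in> carrier G" "y \<in> carrier G" "cls x = cls y"
  shows "x \<otimes> inv y \<in> unit_class" "inv y \<otimes> x \<in> unit_class"
proof -
  have "cls (x \<otimes> inv y) = cls (y \<otimes> inv y)" "cls (inv y \<otimes> x) = cls (inv y \<otimes> y)"
    using assms by (intro cls_mult; simp)+
  then show "x \<otimes> inv y \<in> unit_class" "inv y \<otimes> x \<in> unit_class" using assms by (simp_all add: unit_class_def)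
qed

lemma unit_class_subgroup: "subgroup unit_class G"
proof (rule subgroupI)
  show "inv a \<in> unit_class" if "a \<in> unit_class" for a
    using that cls_inv[of a \<one>] by (simp add: unit_class_def)
  show "a \<otimes> b \<in> unit_class" if "a \<in> unit_class" "b \<in> unit_class" for a b
    using that cls_unit_class_mult[of a b] by (simp add: unit_class_def)
qed (auto simp: unit_class_def)

lemma unit_class_comm_group: "comm_group (G\<lparr>carrier := unit_class\<rparr>)"
proof (rule group.group_comm_groupI)
  show "group (G\<lparr>carrier := unit_class\<rparr>)"
    using unit_class_subgroup is_group by (rule subgroup.subgroup_is_group)
qed (auto simp: unit_class_def intro: unit_class_comm)

lemma unit_class_conj:
  assumes "g \<in> carrier G" "a \<in> unit_class"
  shows "g \<otimes> a \<otimes> inv g \<in> unit_class"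
proof -
  have a: "a \<in> carrier G" using assms(2) by (rule unit_class_carrier)
  have "cls (g \<otimes> a) = cls (g \<otimes> \<one>)" using assms a by (intro cls_mult) (auto simp: unit_class_def)
  then show ?thesis using assms a by (intro div_in_unit_class) auto
qed

text \<open>
  An abelian normal subgroup centralises itself, so its elements are conjugated in the same way by
  any two congruent elements.
\<close>

lemma conj_cong:
  assumes "g \<in> carrier G" "h \<in> carrier G" "cls g = cls h" "b \<in> unit_class"
  shows "g \<otimes> b \<otimes> inv g = h \<otimes> b \<otimes> inv h"
proof -
  define c where "c = inv h \<otimes> g"
  have c: "c \<in> unit_class" unfolding c_def using assms by (intro div_in_unit_class)
  have b: "b \<in> carrier G" "c \<in> carrier G" using assms c unit_class_carrier by auto
  have comm: "c \<otimes> b = b \<otimes> c" using assms(4) c by (intro unit_class_comm) (auto simp: unit_class_def)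
  have "g = h \<otimes> c" using assms by (simp add: c_def cancel_inv)
  then have "g \<otimes> b \<otimes> inv g = h \<otimes> (c \<otimes> b) \<otimes> inv c \<otimes> inv h"
    using assms b by (simp add: inv_mult_group m_assoc)
  also have "\<dots> = h \<otimes> b \<otimes> inv h"
    unfolding comm using assms b by (simp add: m_assoc cancel_inv)
  finally show ?thesis .
qed

text \<open>
  The step from \<open>g\<close> to \<open>g'\<close> and the step from \<open>h\<close> to \<open>h'\<close> are left multiplication by the same element of the
  abelian normal subgroup, and \<open>g\<close> and \<open>h\<close> are congruent. By \<open>conj_cong\<close> the quadruples in this relation form
  a subgroup of \<open>G\<^sup>4\<close>; that is why evaluation of words respects it.
\<close>

definition lockstep :: "'a \<Rightarrow> 'a \<Rightarrow> 'a \<Rightarrow> 'a \<Rightarrow> bool" where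
  "lockstep g g' h h' \<longleftrightarrow> g \<in> carrier G \<and> h \<in> carrier G \<and> cls g = cls h \<and>
     (\<exists>a\<in>unit_class. g' = a \<otimes> g \<and> h' = a \<otimes> h)"

lemma lockstep_refl: "g \<in> carrier G \<Longrightarrow> lockstep g g g g"
  unfolding lockstep_def by (auto intro!: bexI[of _ \<one>] simp: unit_class_def)

lemma lockstep_mult:
  assumes "lockstep g1 g1' h1 h1'" "lockstep g2 g2' h2 h2'"
  shows "lockstep (g1 \<otimes> g2) (g1' \<otimes> g2') (h1 \<otimes> h2) (h1' \<otimes> h2')"
proof -
  obtain a b where a: "a \<in> unit_class" "g1' = a \<otimes> g1" "h1' = a \<otimes> h1"
    and b: "b \<in> unit_class" "g2' = b \<otimes> g2" "h2' = b \<otimes> h2"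
    using assms by (auto simp: lockstep_def)
  have car: "g1 \<in> carrier G" "g2 \<in> carrier G" "h1 \<in> carrier G" "h2 \<in> carrier G"
    and cls: "cls g1 = cls h1" "cls g2 = cls h2"
    using assms by (simp_all add: lockstep_def)
  note ab = unit_class_carrier[OF a(1)] unit_class_carrier[OF b(1)]
  let ?c = "a \<otimes> (g1 \<otimes> b \<otimes> inv g1)"
  have "?c \<in> unit_class"
    by (rule subgroup.m_closed[OF unit_class_subgroup a(1) unit_class_conj[OF car(1) b(1)]])
  moreover have "g1' \<otimes> g2' = ?c \<otimes> (g1 \<otimes> g2)"
    unfolding a b using car ab by (simp add: m_assoc cancel_inv)
  moreover have "h1' \<otimes> h2' = ?c \<otimes> (h1 \<otimes> h2)"
    unfolding a b conj_cong[OF car(1,3) cls(1) b(1)] using car ab by (simp add: m_assoc cancel_inv)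
  moreover have "cls (g1 \<otimes> g2) = cls (h1 \<otimes> h2)" using car cls by (intro cls_mult)
  ultimately show ?thesis using car unfolding lockstep_def by blast
qed

lemma lockstep_inv:
  assumes "lockstep g g' h h'"
  shows "lockstep (inv g) (inv g') (inv h) (inv h')"
proof -
  obtain a where a: "a \<in> unit_class" "g' = a \<otimes> g" "h' = a \<otimes> h"
    using assms by (auto simp: lockstep_def)
  have car: "g \<in> carrier G" "h \<in> carrier G" and cls: "cls g = cls h"
    using assms by (simp_all add: lockstep_def)
  have a': "a \<in> carrier G" "inv a \<in> unit_class"
    using a(1) unit_class_subgroup by (auto simp: unit_class_carrier subgroup.m_inv_closed)
  have cls': "cls (inv g) = cls (inv h)" using car cls by (rule cls_inv)
  let ?c = "inv g \<otimes> inv a \<otimes> inv (inv g)"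
  have "?c \<in> unit_class" using car a' by (intro unit_class_conj) auto
  moreover have "inv g' = ?c \<otimes> inv g"
    unfolding a using car a' by (simp add: m_assoc inv_mult_group)
  moreover have "inv h' = ?c \<otimes> inv h"
    unfolding a conj_cong[OF inv_closed[OF car(1)] inv_closed[OF car(2)] cls' a'(2)]
    using car a' by (simp add: m_assoc inv_mult_group)
  ultimately show ?thesis using car cls' unfolding lockstep_def by auto
qed

lemma lockstep_substitution:
  fixes x x' y y' :: "'a^'n::finite"
  assumes sub: "is_substitution G x \<phi>" "is_substitution G x' \<phi>'" "is_substitution G y \<psi>" "is_substitution G y' \<psi>'"
    and xy: "\<And>i. lockstep (x $ i) (x' $ i) (y $ i) (y' $ i)"
    and w: "w \<in> carrier (equation_group G TYPE('n))"
  shows "lockstep (\<phi> w) (\<phi>' w) (\<psi> w) (\<psi>' w)"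
proof -
  let ?H = "free_group :: ('n \<times> bool) list set monoid" and ?E = "equation_group G TYPE('n)"
  have E: "?E = free_product G ?H" by (simp add: equation_group_def)
  interpret H: group ?H by (rule free_group_group)
  interpret E: group ?E unfolding E by (intro free_product_group is_group free_group_group)
  let ?Q = "\<lambda>w. lockstep (\<phi> w) (\<phi>' w) (\<psi> w) (\<psi>' w)"
  have hom: "\<phi> \<in> hom ?E G" "\<phi>' \<in> hom ?E G" "\<psi> \<in> hom ?E G" "\<psi>' \<in> hom ?E G"
    using sub by (simp_all add: is_substitution_def)
  have one: "?Q \<one>\<^bsub>?E\<^esub>"
    using hom[THEN hom_one, OF E.is_group is_group] lockstep_refl[OF one_closed] by simp
  have mult: "?Q (u \<otimes>\<^bsub>?E\<^esub> v)" if "u \<in> carrier ?E" "v \<in> carrier ?E" "?Q u" "?Q v" for u v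
    using lockstep_mult[OF that(3,4)] hom[THEN hom_mult, OF that(1,2)] by simp
  have invE: "\<theta> (inv\<^bsub>?E\<^esub> u) = inv (\<theta> u)" if "u \<in> carrier ?E" "\<theta> \<in> hom ?E G" for u \<theta>
    using that group_hom.hom_inv[of ?E G \<theta> u] E.is_group is_group
    by (simp add: group_hom_def group_hom_axioms_def)
  have inv: "?Q (inv\<^bsub>?E\<^esub> u)" if "u \<in> carrier ?E" "?Q u" for u
    using lockstep_inv[OF that(2)] invE[OF that(1)] hom by simp
  let ?inr = "free_product_inr G ?H"
  have inr: "?inr \<in> hom ?H ?E" unfolding E by (intro free_product_inr_hom free_group_group)
  have gen_car: "free_gen i \<in> carrier ?H" for i
    by (simp add: free_gen_def free_group_def presented_def)
  have gen: "?Q (?inr (free_gen i))" for i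
    using sub xy by (simp add: is_substitution_def)
  have free: "?Q (?inr h)" if "h \<in> carrier ?H" for h
    using that unfolding free_group_def
  proof (induction h rule: presented_induct)
    case base: one
    have "?inr \<one>\<^bsub>?H\<^esub> = \<one>\<^bsub>?E\<^esub>" using hom_one[OF inr H.is_group E.is_group] .
    then show ?case using one by (simp add: free_group_def)
  next
    case L: (letter a)
    obtain i b where a: "a = (i, b)" by force
    show ?case
    proof (cases b)
      case True
      then show ?thesis using gen[of i] by (simp add: a free_gen_def free_group_def)
    next
      case False
      have "?inr (inv\<^bsub>?H\<^esub> (free_gen i)) = inv\<^bsub>?E\<^esub> (?inr (free_gen i))"
        using group_hom.hom_inv[of ?H ?E ?inr "free_gen i"] inr gen_car H.is_group E.is_group
        by (simp add: group_hom_def group_hom_axioms_def)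
      moreover have "?inr (free_gen i) \<in> carrier ?E" using inr gen_car by (rule hom_in_carrier)
      ultimately have "?Q (?inr (inv\<^bsub>?H\<^esub> (free_gen i)))" using inv gen by simp
      then show ?thesis using False
        by (simp add: a free_group_inverse_letter[symmetric]) (simp add: free_group_def)
    qed
  next
    case M: (mult u v)
    note M = M[folded free_group_def]
    have "?inr (u \<otimes>\<^bsub>?H\<^esub> v) = ?inr u \<otimes>\<^bsub>?E\<^esub> ?inr v" using inr M(1,2) by (rule hom_mult)
    then have "?Q (?inr (u \<otimes>\<^bsub>?H\<^esub> v))"
      using mult[OF hom_in_carrier[OF inr M(1)] hom_in_carrier[OF inr M(2)] M(3,4)] by simp
    then show ?case by (simp add: free_group_def)
  qed
  have "w \<in> carrier (presented (free_product_letters G ?H) (free_product_rels G ?H))"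
    using w by (simp add: E free_product_def)
  then show ?thesis
  proof (induction w rule: presented_induct)
    case base: one
    then show ?case using one by (simp add: E free_product_def)
  next
    case L: (letter a)
    then consider g where "a = Inl g" "g \<in> carrier G" | h where "a = Inr h" "h \<in> carrier ?H"
      by (auto simp: free_product_letters_def)
    then show ?case
    proof cases
      case 1
      have "?Q (free_product_inl G ?H g)"
        using sub 1(2) lockstep_refl by (simp add: is_substitution_def)
      then show ?thesis by (simp add: 1 free_product_inl_def)
    next
      case 2
      then show ?thesis using free[of h] by (simp add: free_product_inr_def)
    qed
  next
    case M: (mult u v)
    then show ?case using mult[of u v] by (simp add: E free_product_def)
  qed
qed

text \<open>
  Algebraic sets are affine within each class of congruent tuples: moving \<open>x\<close> to \<open>x'\<close> changes the value of
  a word by left multiplication with some \<open>a\<close>, and moving \<open>y\<close> to \<open>y'\<close> changes it by the same \<open>a\<close>. If \<open>x\<close> and \<open>x'\<close>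
  are solutions then \<open>a = \<one>\<close>, so with \<open>y\<close> also \<open>y'\<close> is a solution.
\<close>

lemma solution_set_lockstep:
  fixes x x' y y' :: "'a^'n::finite"
  assumes W: "W \<subseteq> carrier (equation_group G TYPE('n))"
    and V: "x \<in> solution_set G W" "x' \<in> solution_set G W" "y \<in> solution_set G W"
    and xy: "\<And>i. lockstep (x $ i) (x' $ i) (y $ i) (y' $ i)"
  shows "y' \<in> solution_set G W"
proof -
  obtain \<phi> where \<phi>: "is_substitution G x \<phi>" "\<forall>w\<in>W. \<phi> w = \<one>"
    using V(1) by (auto simp: solution_set_def)
  obtain \<phi>' where \<phi>': "is_substitution G x' \<phi>'" "\<forall>w\<in>W. \<phi>' w = \<one>"
    using V(2) by (auto simp: solution_set_def)
  obtain \<psi> where \<psi>: "is_substitution G y \<psi>" "\<forall>w\<in>W. \<psi> w = \<one>"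
    using V(3) by (auto simp: solution_set_def)
  have car: "y' $ i \<in> carrier G" for i
    using xy[of i] by (auto simp: lockstep_def dest: unit_class_carrier)
  obtain \<psi>' where \<psi>': "is_substitution G y' \<psi>'" using is_substitution_exists[of y'] car by blast
  have "\<psi>' w = \<one>" if "w \<in> W" for w
  proof -
    have "lockstep (\<phi> w) (\<phi>' w) (\<psi> w) (\<psi>' w)"
      using W that by (intro lockstep_substitution[OF \<phi>(1) \<phi>'(1) \<psi>(1) \<psi>' xy]) auto
    then obtain a where a: "a \<in> unit_class" "\<phi>' w = a \<otimes> \<phi> w" "\<psi>' w = a \<otimes> \<psi> w"
      unfolding lockstep_def by blast
    then have "\<one> = a \<otimes> \<one>" "\<psi>' w = a \<otimes> \<one>"
      using \<phi>(2) \<phi>'(2) \<psi>(2) that by simp_all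
    then show ?thesis by simp
  qed
  then show ?thesis using car \<psi>' by (auto simp: solution_set_def)
qed

end

section \<open>Words as walks in the Schreier graph\<close>

text \<open>
  The vertices are the congruence classes, and an edge \<open>(q, s)\<close> is the multiplication of \<open>q\<close> by the letter
  \<open>s\<close> from the right. A word is a walk from the class of the unit, and its value is the product of the
  labels along the walk, times the representative of the last vertex. The labels lie in an abelian
  group, so the order of the edges is irrelevant for the value.
\<close>

locale schreier_graph = abelian_kernel_congruence G cls for G (structure) and cls :: "'a \<Rightarrow> 'q" +
  fixes S :: "'a set"
  assumes finite_S: "finite S" and S_carrier: "S \<subseteq> carrier G"
begin

text \<open>
  The class of the unit is represented by the unit, so that the empty walk has the value of the empty
  word.
\<close>

definition rep :: "'q \<Rightarrow> 'a" where
  "rep q = (if q = cls \<one> then \<one> else SOME g. g \<in> carrier G \<and> cls g = q)"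

lemma rep: "q \<in> cls ` carrier G \<Longrightarrow> rep q \<in> carrier G \<and> cls (rep q) = q"
  unfolding rep_def using someI_ex[of "\<lambda>g. g \<in> carrier G \<and> cls g = q"] by auto

definition edges :: "('q \<times> 'a) set" where
  "edges = cls ` carrier G \<times> S"

definition target :: "'q \<times> 'a \<Rightarrow> 'q" where
  "target e = cls (rep (fst e) \<otimes> snd e)"

definition label :: "'q \<times> 'a \<Rightarrow> 'a" where
  "label e = rep (fst e) \<otimes> snd e \<otimes> inv (rep (target e))"

lemma finite_edges: "finite edges"
  using finite_classes finite_S by (simp add: edges_def)

lemma edge_source:
  "e \<in> edges \<Longrightarrow> rep (fst e) \<in> carrier G \<and> snd e \<in> S \<and> snd e \<in> carrier G"
  using rep S_carrier by (auto simp: edges_def)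

lemma edge_target:
  assumes "e \<in> edges"
  shows "rep (target e) \<in> carrier G" "cls (rep (target e)) = target e" "target e \<in> cls ` carrier G"
proof -
  show "target e \<in> cls ` carrier G"
    using edge_source[OF assms] by (auto simp: target_def)
  then show "rep (target e) \<in> carrier G" "cls (rep (target e)) = target e"
    using rep by blast+
qed

lemma label_in_unit_class: "e \<in> edges \<Longrightarrow> label e \<in> unit_class"
  unfolding label_def using edge_source[of e] edge_target[of e]
  by (intro div_in_unit_class) (auto simp: target_def)

definition val :: "('q \<times> 'a) multiset \<Rightarrow> 'a" where
  "val v = finprod (G\<lparr>carrier := unit_class\<rparr>)
     (\<lambda>e. label e [^]\<^bsub>G\<lparr>carrier := unit_class\<rparr>\<^esub> count v e) edges"

lemma val_in_unit_class: "val v \<in> unit_class"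
proof -
  interpret U: comm_group "G\<lparr>carrier := unit_class\<rparr>" by (rule unit_class_comm_group)
  have "val v \<in> carrier (G\<lparr>carrier := unit_class\<rparr>)"
    unfolding val_def using label_in_unit_class by (intro U.finprod_closed funcsetI U.nat_pow_closed) simp
  then show ?thesis by simp
qed

lemma val_empty: "val {#} = \<one>"
proof -
  interpret U: comm_group "G\<lparr>carrier := unit_class\<rparr>" by (rule unit_class_comm_group)
  have "val {#} = \<one>\<^bsub>G\<lparr>carrier := unit_class\<rparr>\<^esub>"
    unfolding val_def by (rule U.finprod_one_eqI) simp
  then show ?thesis by simp
qed

lemma val_add: "val (u + v) = val u \<otimes> val v"
proof -
  let ?U = "G\<lparr>carrier := unit_class\<rparr>"
  interpret U: comm_group ?U by (rule unit_class_comm_group)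
  have l: "label e \<in> carrier ?U" if "e \<in> edges" for e
    using label_in_unit_class[OF that] by simp
  have "val (u + v) = finprod ?U (\<lambda>e. (label e [^]\<^bsub>?U\<^esub> count u e) \<otimes>\<^bsub>?U\<^esub> (label e [^]\<^bsub>?U\<^esub> count v e)) edges"
    unfolding val_def count_union
    by (intro U.finprod_cong'[OF HOL.refl] funcsetI U.m_closed U.nat_pow_closed l U.nat_pow_mult[symmetric])
  also have "\<dots> = val u \<otimes>\<^bsub>?U\<^esub> val v"
    unfolding val_def by (rule U.finprod_multf) (rule funcsetI, rule U.nat_pow_closed, erule l)+
  finally show ?thesis by simp
qed

lemma val_single:
  assumes "e \<in> edges"
  shows "val {#e#} = label e"
proof -
  let ?U = "G\<lparr>carrier := unit_class\<rparr>"
  interpret U: comm_group ?U by (rule unit_class_comm_group)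
  have l: "label e \<in> carrier ?U" if "e \<in> edges" for e
    using label_in_unit_class[OF that] by simp
  have "val {#e#} = finprod ?U (\<lambda>f. if e = f then label f else \<one>\<^bsub>?U\<^esub>) edges"
    unfolding val_def
  proof (rule U.finprod_cong')
    show "(\<lambda>f. if e = f then label f else \<one>\<^bsub>?U\<^esub>) \<in> edges \<rightarrow> carrier ?U"
      using l U.one_closed by (intro funcsetI) presburger
    show "label f [^]\<^bsub>?U\<^esub> count {#e#} f = (if e = f then label f else \<one>\<^bsub>?U\<^esub>)" if "f \<in> edges" for f
      using U.l_one[OF l[OF that]] U.nat_pow_0[of "label f"] U.nat_pow_Suc[of "label f" 0] by simp
  qed simp
  also have "\<dots> = label e"
    using l by (intro U.finprod_singleton assms finite_edges funcsetI)
  finally show ?thesis .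
qed

lemma val_snoc:
  assumes "e \<in> edges"
  shows "val (add_mset e v) \<otimes> rep (target e) = val v \<otimes> rep (fst e) \<otimes> snd e"
proof -
  have "val (add_mset e v) = val v \<otimes> label e"
    using val_add[of v "{#e#}"] val_single[OF assms] by simp
  then show ?thesis
    using edge_source[OF assms] edge_target(1)[OF assms] unit_class_carrier[OF val_in_unit_class]
    by (simp add: label_def m_assoc)
qed

lemma word_in_carrier: "w \<in> lists S \<Longrightarrow> word_eval G (\<lambda>s. s) w \<in> carrier G"
  using S_carrier by (intro word_eval_closed[of _ S]) auto

lemma word_eval_snoc:
  "w \<in> lists S \<Longrightarrow> s \<in> S \<Longrightarrow> word_eval G (\<lambda>s. s) (w @ [s]) = word_eval G (\<lambda>s. s) w \<otimes> s"
  using S_carrier by (subst word_eval_append[of _ S]) auto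

lemma walk_word:
  assumes "walk fst target (cls \<one>) v q" "set_mset v \<subseteq> edges"
  shows "\<exists>w\<in>lists S. word_eval G (\<lambda>s. s) w = val v \<otimes> rep q \<and> word_weight \<omega> w = (\<Sum>e\<in>#v. \<omega> (snd e))"
  using assms
proof (induction rule: walk.induct)
  case empty
  then show ?case by (intro bexI[of _ "[]"]) (simp_all add: val_empty rep_def word_weight_def)
next
  case (snoc v e)
  then obtain w where w: "w \<in> lists S" "word_eval G (\<lambda>s. s) w = val v \<otimes> rep (fst e)"
    "word_weight \<omega> w = (\<Sum>e\<in>#v. \<omega> (snd e))" by auto
  have e: "e \<in> edges" using snoc.prems by simp
  then have s: "snd e \<in> S" using edge_source by blast
  show ?case
  proof (rule bexI)
    show "word_eval G (\<lambda>s. s) (w @ [snd e]) = val (add_mset e v) \<otimes> rep (target e) \<and>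
        word_weight \<omega> (w @ [snd e]) = (\<Sum>e\<in>#add_mset e v. \<omega> (snd e))"
      using word_eval_snoc[OF w(1) s] w(2,3) val_snoc[OF e] by (simp add: word_weight_def)
    show "w @ [snd e] \<in> lists S" using w(1) s by simp
  qed
qed

lemma word_walk:
  assumes "w \<in> lists S"
  shows "\<exists>v. set_mset v \<subseteq> edges \<and> walk fst target (cls \<one>) v (cls (word_eval G (\<lambda>s. s) w)) \<and>
    word_eval G (\<lambda>s. s) w = val v \<otimes> rep (cls (word_eval G (\<lambda>s. s) w)) \<and>
    word_weight \<omega> w = (\<Sum>e\<in>#v. \<omega> (snd e))"
  using assms
proof (induction w rule: rev_induct)
  case Nil
  then show ?case
    by (intro exI[of _ "{#}"]) (auto simp: val_empty rep_def word_weight_def intro: walk.empty)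
next
  case (snoc s w)
  then have w: "w \<in> lists S" and s: "s \<in> S" by auto
  define g where "g = word_eval G (\<lambda>s. s) w"
  have g: "g \<in> carrier G" unfolding g_def using w by (rule word_in_carrier)
  obtain v where v: "set_mset v \<subseteq> edges" "walk fst target (cls \<one>) v (cls g)"
    "g = val v \<otimes> rep (cls g)" "word_weight \<omega> w = (\<Sum>e\<in>#v. \<omega> (snd e))"
    using snoc.IH[OF w] unfolding g_def by blast
  define e where "e = (cls g, s)"
  have e: "e \<in> edges" using g s by (auto simp: e_def edges_def)
  have eval: "word_eval G (\<lambda>s. s) (w @ [s]) = g \<otimes> s"
    unfolding g_def using w s by (rule word_eval_snoc)
  have tgt: "target e = cls (g \<otimes> s)"
    unfolding target_def e_def fst_conv snd_conv using g s rep[of "cls g"] S_carrier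
    by (intro cls_mult) auto
  have "walk fst target (cls \<one>) (add_mset e v) (target e)"
    using v(2) by (intro walk.snoc) (simp add: e_def)
  moreover have "g \<otimes> s = val (add_mset e v) \<otimes> rep (target e)"
    using val_snoc[OF e, of v] v(3) by (simp add: e_def)
  ultimately show ?case
    unfolding eval tgt using v(1,4) e
    by (intro exI[of _ "add_mset e v"]) (simp add: word_weight_def e_def)
qed

text \<open>
  The tuples of words for the points of \<open>V\<close> are tuples of walks in the Schreier graph. For fixed end
  points and fixed sets of edges in use, these are translation-closed by
  \<open>walks_translation_closed\<close> and by the affineness of \<open>V\<close>, and the point together with the weights of the
  words is an affine function of them. So \<open>W\<close> is a finite union of pieces.
\<close>

lemma words_rational:
  fixes V :: "('a^'n::finite) set"
  assumes V: "\<And>x i. x \<in> V \<Longrightarrow> x $ i \<in> carrier G"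
    and affine: "\<And>x x' y y'. x \<in> V \<Longrightarrow> x' \<in> V \<Longrightarrow> y \<in> V \<Longrightarrow>
      (\<And>i. lockstep (x $ i) (x' $ i) (y $ i) (y' $ i)) \<Longrightarrow> y' \<in> V"
    and W: "W = {(x, m :: nat^'n). x \<in> V \<and>
      (\<forall>i. \<exists>w\<in>lists S. word_eval G (\<lambda>s. s) w = x $ i \<and> word_weight \<omega> w = m $ i)}"
    and fin: "finite_fibres snd W"
  shows "mfps_rational (weight_gf snd W)"
proof -
  define X where "X = {x :: 'a^'n. \<forall>i. x $ i \<in> carrier G} \<times> (UNIV :: (nat^'n) set)"
  define move where "move \<delta> k = (\<lambda>(x, m). (\<chi> i. \<delta> i \<otimes> x $ i, m + k))"
    for \<delta> :: "'n \<Rightarrow> 'a" and k :: "nat^'n"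
  define T where "T = {move \<delta> k | \<delta> k. \<forall>i. \<delta> i \<in> unit_class}"
  interpret graded_translations X T snd
  proof
    fix \<sigma> \<tau> p q assume T: "\<sigma> \<in> T" "\<tau> \<in> T" and X: "p \<in> X" "q \<in> X" and eq: "\<sigma> p = \<tau> p"
    obtain \<delta> k where \<sigma>: "\<sigma> = move \<delta> k" "\<And>i. \<delta> i \<in> unit_class" using T(1) by (auto simp: T_def)
    obtain \<delta>' k' where \<tau>: "\<tau> = move \<delta>' k'" "\<And>i. \<delta>' i \<in> unit_class" using T(2) by (auto simp: T_def)
    have "\<delta> i = \<delta>' i" for i
    proof -
      have "\<delta> i \<otimes> fst p $ i = \<delta>' i \<otimes> fst p $ i"
        using eq by (simp add: \<sigma>(1) \<tau>(1) move_def split_beta vec_eq_iff)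
      then show ?thesis
        using X(1) \<sigma>(2)[of i] \<tau>(2)[of i] unit_class_carrier by (auto simp: X_def)
    qed
    moreover have "k = k'" using eq by (simp add: \<sigma>(1) \<tau>(1) move_def split_beta)
    ultimately show "\<sigma> q = \<tau> q" by (simp add: \<sigma>(1) \<tau>(1) move_def)
  next
    fix \<tau> assume "\<tau> \<in> T"
    then show "\<exists>k. \<forall>x\<in>X. snd (\<tau> x) = snd x + k" by (auto simp: T_def move_def split_beta)
  qed
  define pt where "pt q u = (\<chi> i. val (component i u) \<otimes> rep (q i))"
    for q :: "'n \<Rightarrow> 'q" and u :: "('n \<times> ('q \<times> 'a)) multiset"
  define wt where "wt u = (\<chi> i. \<Sum>e\<in>#component i u. \<omega> (snd e))"
    for u :: "('n \<times> ('q \<times> 'a)) multiset"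
  \<comment> \<open>\<open>fst j\<close> prescribes the end points of the walks and \<open>snd j\<close> the sets of edges in use.\<close>
  define C where "C j = {u. (\<forall>i. component i u \<in> {v. walk fst target (cls \<one>) v (fst j i) \<and> set_mset v = snd j i})
      \<and> pt (fst j) u \<in> V}" for j :: "('n \<Rightarrow> 'q) \<times> ('n \<Rightarrow> ('q \<times> 'a) set)"
  define h where "h j u = (pt (fst j) u, wt u)"
    for j :: "('n \<Rightarrow> 'q) \<times> ('n \<Rightarrow> ('q \<times> 'a) set)" and u
  define I :: "(('n \<Rightarrow> 'q) \<times> ('n \<Rightarrow> ('q \<times> 'a) set)) set" where "I = (UNIV \<rightarrow>\<^sub>E cls ` carrier G) \<times> (UNIV \<rightarrow>\<^sub>E Pow edges)"
  have I: "finite I"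
    unfolding I_def using finite_classes finite_edges by (intro finite_cartesian_product finite_PiE) auto
  have jI: "fst j i \<in> cls ` carrier G" "snd j i \<subseteq> edges" if "j \<in> I" for j i
    using that unfolding I_def mem_Times_iff PiE_UNIV_domain Pi_iff by blast+
  have hX: "h j u \<in> X" if "j \<in> I" for j u
    using rep[OF jI(1)[OF that]] unit_class_carrier[OF val_in_unit_class] by (simp add: h_def X_def pt_def)
  have h_add: "h j (u + d) = move (\<lambda>i. val (component i d)) (wt d) (h j u)" if "j \<in> I" for j u d
  proof -
    have "val (component i (u + d)) \<otimes> rep (fst j i) = val (component i d) \<otimes> (val (component i u) \<otimes> rep (fst j i))" for i
    proof -
      have "val (component i (u + d)) = val (component i d) \<otimes> val (component i u)"
        using val_add[of "component i d" "component i u"] by (simp add: add.commute)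
      then show ?thesis
        using rep[OF jI(1)[OF that]] unit_class_carrier[OF val_in_unit_class] by (simp add: m_assoc)
    qed
    moreover have "wt (u + d) = wt u + wt d" by (simp add: wt_def vec_eq_iff)
    ultimately show ?thesis by (simp add: h_def move_def pt_def)
  qed
  have piece: "piece (C j) (h j)" if j: "j \<in> I" for j
    unfolding piece_def
  proof (intro conjI ballI allI impI)
    show "\<exists>K. finite K \<and> C j \<subseteq> {u. set_mset u \<subseteq> K}"
    proof (intro exI[of _ "UNIV \<times> edges"] conjI subsetI CollectI)
      fix u p assume u: "u \<in> C j" and p: "p \<in># u"
      have "snd p \<in># component (fst p) u" using p by (simp add: set_component)
      then have "snd p \<in> edges" using u jI(2)[OF j, of "fst p"] by (auto simp: C_def)
      then show "p \<in> UNIV \<times> edges" by (simp add: mem_Times_iff)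
    qed (simp add: finite_edges)
    have CD: "component i u \<in> {v. walk fst target (cls \<one>) v (fst j i) \<and> set_mset v = snd j i}"
      if "u \<in> C j" for u i
      using that by (simp add: C_def)
    show "translation_closed (C j)"
      unfolding translation_closed_def
    proof (intro ballI allI impI)
      fix x y d assume x: "x \<in> C j" "x + d \<in> C j" and y: "y \<in> C j"
      let ?w = "\<lambda>i. {v. walk fst target (cls \<one>) v (fst j i) \<and> set_mset v = snd j i}"
      have "component i (y + d) \<in> ?w i" for i
        using translation_closedD[OF walks_translation_closed CD(1)[OF x(1)]
            CD(1)[OF x(2), unfolded component_add] CD(1)[OF y]] unfolding component_add .
      moreover have "pt (fst j) (y + d) \<in> V"
      proof (rule affine)
        show "pt (fst j) x \<in> V" "pt (fst j) (x + d) \<in> V" "pt (fst j) y \<in> V"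
          using x y by (simp_all add: C_def)
        fix i
        let ?r = "rep (fst j i)" and ?a = "val (component i d)"
        have r: "?r \<in> carrier G" using rep[OF jI(1)[OF j]] by blast
        have add: "pt (fst j) (u + d) $ i = ?a \<otimes> pt (fst j) u $ i" for u
          using h_add[OF j, of u d] by (simp add: h_def move_def vec_eq_iff)
        have "cls (pt (fst j) u $ i) = cls ?r" for u
          using cls_unit_class_mult[OF val_in_unit_class r] by (simp add: pt_def)
        moreover have "pt (fst j) u $ i \<in> carrier G" for u
          using r unit_class_carrier[OF val_in_unit_class] by (simp add: pt_def)
        ultimately show "lockstep (pt (fst j) x $ i) (pt (fst j) (x + d) $ i) (pt (fst j) y $ i) (pt (fst j) (y + d) $ i)"
          unfolding lockstep_def add using val_in_unit_class[of "component i d"] by auto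
      qed
      ultimately show "y + d \<in> C j" unfolding C_def by blast
    qed
    show "h j ` C j \<subseteq> X" using hX[OF j] by blast
    show "\<exists>\<tau>\<in>T. \<forall>y\<in>C j. h j (y + d) = \<tau> (h j y)" for d
      using h_add[OF j] val_in_unit_class
      by (intro bexI[of _ "move (\<lambda>i. val (component i d)) (wt d)"]) (auto simp: T_def)
  qed
  have "W = (\<Union>j\<in>I. h j ` C j)"
  proof
    show "(\<Union>j\<in>I. h j ` C j) \<subseteq> W"
    proof clarify
      fix j u x m assume j: "j \<in> I" and u: "u \<in> C j" and xm: "(x, m) = h j u"
      have "\<exists>w\<in>lists S. word_eval G (\<lambda>s. s) w = x $ i \<and> word_weight \<omega> w = m $ i" for i
        using walk_word[of "component i u" "fst j i" \<omega>] u jI(2)[OF j, of i] xm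
        by (auto simp: C_def h_def pt_def wt_def)
      then show "(x, m) \<in> W" using u xm by (simp add: W C_def h_def)
    qed
    show "W \<subseteq> (\<Union>j\<in>I. h j ` C j)"
    proof clarify
      fix x m assume xm: "(x, m) \<in> W"
      then have x: "x \<in> V" by (simp add: W)
      have "\<exists>v. set_mset v \<subseteq> edges \<and> walk fst target (cls \<one>) v (cls (x $ i)) \<and>
          x $ i = val v \<otimes> rep (cls (x $ i)) \<and> m $ i = (\<Sum>e\<in>#v. \<omega> (snd e))" for i
      proof -
        obtain w where "w \<in> lists S" "word_eval G (\<lambda>s. s) w = x $ i" "word_weight \<omega> w = m $ i"
          using xm by (auto simp: W)
        then show ?thesis using word_walk[of w \<omega>] by simp
      qed
      then obtain v where v: "\<And>i. set_mset (v i) \<subseteq> edges" "\<And>i. walk fst target (cls \<one>) (v i) (cls (x $ i))"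
        "\<And>i. x $ i = val (v i) \<otimes> rep (cls (x $ i))" "\<And>i. m $ i = (\<Sum>e\<in>#v i. \<omega> (snd e))" by metis
      obtain u where "\<And>i. i \<in> UNIV \<Longrightarrow> component i u = v i" "set_mset u \<subseteq> (SIGMA i:UNIV. set_mset (v i))"
        using component_surj[OF finite[of UNIV], of v] by blast
      then have u: "component i u = v i" for i by simp
      define j where "j = (\<lambda>i. cls (x $ i), \<lambda>i. set_mset (v i))"
      have "j \<in> I" using v(1) V[OF x] by (auto simp: I_def j_def PiE_iff)
      moreover have pt: "pt (fst j) u = x" using v(3) by (simp add: pt_def j_def u vec_eq_iff)
      moreover have "wt u = m" using v(4) by (simp add: wt_def u vec_eq_iff)
      moreover have "u \<in> C j" using v(2) x pt by (simp add: C_def u) (simp add: j_def)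
      ultimately show "(x, m) \<in> (\<Union>j\<in>I. h j ` C j)" by (force simp: h_def)
    qed
  qed
  then show ?thesis using pieces_rational[OF I piece] fin by simp
qed

end

context group
begin

section \<open>Weights and virtually abelian groups\<close>

text \<open>
  Allowing the unit as a letter of weight one turns words of weight at most \<open>m\<close> into words of weight
  exactly \<open>m\<close>: the weight that is left is filled with units. If the unit belongs to \<open>S\<close>, its weight may be
  lowered to one, since it does not help to represent an element.
\<close>

lemma elem_weight_le_iff:
  assumes S: "word_generates G S" and pos: "\<forall>s\<in>S. \<omega> s > 0" and g: "g \<in> carrier G"
  shows "elem_weight G S \<omega> g \<le> m \<longleftrightarrow>
    (\<exists>w\<in>lists (insert \<one> S). word_eval G (\<lambda>s. s) w = g \<and> word_weight (\<omega>(\<one> := 1)) w = m)"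
proof
  have car: "S \<subseteq> carrier G" using S by (simp add: word_generates_def)
  have lists_car: "(\<lambda>s. s) \<in> insert \<one> S \<rightarrow> carrier G" using car by auto
  assume le: "elem_weight G S \<omega> g \<le> m"
  have "\<exists>k. \<exists>w\<in>lists S. word_eval G (\<lambda>s. s) w = g \<and> word_weight \<omega> w = k"
    using S g unfolding word_generates_def by blast
  from LeastI_ex[OF this]
  obtain w where w: "w \<in> lists S" "word_eval G (\<lambda>s. s) w = g" "word_weight \<omega> w = elem_weight G S \<omega> g"
    unfolding elem_weight_def by blast
  have "word_weight (\<omega>(\<one> := 1)) w \<le> word_weight \<omega> w"
    using w(1) pos by (induction w) (auto simp: word_weight_def Suc_le_eq add_mono)
  then have wm: "word_weight (\<omega>(\<one> := 1)) w \<le> m" using w(3) le by simp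
  have eval: "word_eval G (\<lambda>s. s) (replicate k \<one> @ w) = g" for k
    by (induction k) (simp_all add: w(2) g)
  have weight: "word_weight (\<omega>(\<one> := 1)) (replicate k \<one> @ w) = k + word_weight (\<omega>(\<one> := 1)) w" for k
    by (induction k) (simp_all add: word_weight_def)
  show "\<exists>w\<in>lists (insert \<one> S). word_eval G (\<lambda>s. s) w = g \<and> word_weight (\<omega>(\<one> := 1)) w = m"
    using w(1) wm eval weight
    by (intro bexI[of _ "replicate (m - word_weight (\<omega>(\<one> := 1)) w) \<one> @ w"]) auto
next
  have car: "S \<subseteq> carrier G" using S by (simp add: word_generates_def)
  assume "\<exists>w\<in>lists (insert \<one> S). word_eval G (\<lambda>s. s) w = g \<and> word_weight (\<omega>(\<one> := 1)) w = m"
  then obtain w where w: "w \<in> lists (insert \<one> S)" "word_eval G (\<lambda>s. s) w = g"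
    "word_weight (\<omega>(\<one> := 1)) w = m" by blast
  let ?w = "filter (\<lambda>s. s \<noteq> \<one>) w"
  have "word_eval G (\<lambda>s. s) ?w = word_eval G (\<lambda>s. s) w \<and> word_eval G (\<lambda>s. s) w \<in> carrier G"
    using w(1) car by (induction w) auto
  moreover have "word_weight \<omega> ?w \<le> word_weight (\<omega>(\<one> := 1)) w"
    by (induction w) (auto simp: word_weight_def)
  moreover have "?w \<in> lists S" using w(1) by auto
  ultimately have "elem_weight G S \<omega> g \<le> word_weight \<omega> ?w"
    unfolding elem_weight_def using w(2) by (intro Least_le) auto
  then show "elem_weight G S \<omega> g \<le> m"
    using \<open>word_weight \<omega> ?w \<le> word_weight (\<omega>(\<one> := 1)) w\<close> w(3) by simp
qed

text \<open>
  The action on the right cosets of an abelian subgroup \<open>H\<close> of finite index, with \<open>cls g\<close> the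
  permutation induced by \<open>g\<close>. Elements acting trivially fix the coset \<open>H\<close>, so they belong to \<open>H\<close>.
\<close>

lemma virtually_abelian_congruence:
  assumes "virtually_abelian G"
  shows "\<exists>cls :: 'a \<Rightarrow> 'a set \<Rightarrow> 'a set. abelian_kernel_congruence G cls"
proof -
  obtain H where H: "subgroup H G" "finite (rcosets H)" "comm_group (G\<lparr>carrier := H\<rparr>)"
    using assms by (auto simp: virtually_abelian_def)
  interpret H: comm_group "G\<lparr>carrier := H\<rparr>" by (rule H(3))
  have HG: "H \<subseteq> carrier G" using H(1) by (rule subgroup.subset)
  define cls where "cls g = (\<lambda>C\<in>rcosets H. C #> g)" for g
  have act: "C #> g \<in> rcosets H" if "C \<in> rcosets H" "g \<in> carrier G" for C g
    using that HG by (auto simp: RCOSETS_def coset_mult_assoc)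
  have sub: "C \<subseteq> carrier G" if "C \<in> rcosets H" for C
    using subgroup.rcosets_carrier[OF H(1) is_group that] .
  have H1: "H \<in> rcosets H" using subgroup.subgroup_in_rcosets[OF H(1) is_group] .
  have "abelian_kernel_congruence G cls"
  proof
    have "cls ` carrier G \<subseteq> rcosets H \<rightarrow>\<^sub>E rcosets H"
      using act by (auto simp: cls_def)
    then show "finite (cls ` carrier G)"
      by (rule finite_subset) (intro finite_PiE H(2))
    fix x x' y y' assume car: "x \<in> carrier G" "x' \<in> carrier G" "y \<in> carrier G" "y' \<in> carrier G"
      and eq: "cls x = cls x'" "cls y = cls y'"
    have app: "C #> x = C #> x'" "C #> y = C #> y'" if "C \<in> rcosets H" for C
      using fun_cong[OF eq(1), of C] fun_cong[OF eq(2), of C] that by (simp_all add: cls_def)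
    have "C #> (x \<otimes> y) = C #> (x' \<otimes> y')" if "C \<in> rcosets H" for C
      using app(1)[OF that] app(2)[OF act[OF that car(1)]] car sub[OF that]
      by (simp add: coset_mult_assoc[symmetric])
    then show "cls (x \<otimes> y) = cls (x' \<otimes> y')" by (auto simp: cls_def fun_eq_iff restrict_def)
  next
    have inH: "a \<in> H" if "a \<in> carrier G" "cls a = cls \<one>" for a
    proof -
      have "H #> a = H #> \<one>" using fun_cong[OF that(2), of H] H1 by (simp add: cls_def)
      then have "H #> a = H" using HG by simp
      then show ?thesis using H(1) that(1) by (metis coset_join1 HG)
    qed
    fix a b assume "a \<in> carrier G" "b \<in> carrier G" "cls a = cls \<one>" "cls b = cls \<one>"
    then show "a \<otimes> b = b \<otimes> a" using H.m_comm[of a b] inH by simp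
  qed
  then show ?thesis by blast
qed

end

theorem corollary4p21:
  fixes G :: "('a, 'b) monoid_scheme"
    and V :: "('a^'n::finite) set"
    and S :: "'a set"
    and \<omega> :: "'a \<Rightarrow> nat"
  assumes "group G"
    and "finitely_generated G"
    and "virtually_abelian G"
    and "algebraic_set G V"
    and "finite S"
    and "word_generates G S"
    and "\<forall>s\<in>S. \<omega> s > 0"
  shows "holonomic (growth_series G S \<omega> V)"
proof (rule mfps_rational_imp_holonomic)
  interpret group G by (rule assms(1))
  obtain cls :: "'a \<Rightarrow> 'a set \<Rightarrow> 'a set" where cls: "abelian_kernel_congruence G cls"
    using virtually_abelian_congruence[OF assms(3)] by blast
  interpret schreier_graph G cls "insert \<one>\<^bsub>G\<^esub> S"
    using cls assms(5,6) by (auto simp: schreier_graph_def schreier_graph_axioms_def word_generates_def)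
  obtain W where W: "W \<subseteq> carrier (equation_group G TYPE('n))" "V = solution_set G W"
    using assms(4) by (auto simp: algebraic_set_def)
  have V: "x $ i \<in> carrier G" if "x \<in> V" for x i
    using that by (simp add: W(2) solution_set_def)
  define wt :: "'a^'n \<Rightarrow> nat^'n" where "wt x = (\<chi> i. elem_weight G S \<omega> (x $ i))" for x
  have fin: "finite_fibres wt V"
    unfolding finite_fibres_def wt_def vec_eq_iff vec_lambda_beta
    using finite_elem_weight_vec[OF assms(5-7)] V by blast
  have "mfps_rational (weight_gf snd (slack wt V UNIV))"
  proof (rule words_rational)
    show "x $ i \<in> carrier G" if "x \<in> V" for x i using that by (rule V)
    show "y' \<in> V" if "x \<in> V" "x' \<in> V" "y \<in> V" "\<And>i. lockstep (x $ i) (x' $ i) (y $ i) (y' $ i)"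
      for x x' y y'
      using solution_set_lockstep[OF W(1)] that unfolding W(2) by blast
    show "slack wt V UNIV = {(x, m). x \<in> V \<and> (\<forall>i. \<exists>w\<in>lists (insert \<one>\<^bsub>G\<^esub> S).
        word_eval G (\<lambda>s. s) w = x $ i \<and> word_weight (\<omega>(\<one>\<^bsub>G\<^esub> := 1)) w = m $ i)}"
      using elem_weight_le_iff[OF assms(6,7)] V by (auto simp: slack_def wt_def)
    show "finite_fibres snd (slack wt V UNIV)" using fin by (rule finite_fibres_slack)
  qed
  then have "mfps_rational (weight_gf wt V)" by (rule slack_rational[OF fin])
  also have "weight_gf wt V = growth_series G S \<omega> V"
    by (simp add: weight_gf_def growth_series_def wt_def vec_eq_iff)
  finally show "mfps_rational (growth_series G S \<omega> V :: (complex, 'n) mfps)" .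
qed

end
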